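(* Let $\varphi\colon T\rightarrow S$ be a morphism of Tambara functors on $G$. Then the family $\mathrm{Ker}\,\varphi=\{\mathrm{Ker}(\varphi_X)\}_{X}$, where $X$ runs over all finite $G$-sets and $\mathrm{Ker}(\varphi_X)\subseteq T(X)$ is the kernel of the ring homomorphism $\varphi_X\colon T(X)\to S(X)$, is an ideal of $T$.
   Context: $G$ is a fixed finite group; ${}_G\mathrm{set}$ is the category of finite $G$-sets and $G$-equivariant maps. Rings and monoids are commutative with unit. Semi-Mackey functor $M=(M^*,M_* )$ on $G$: a contravariant functor $M^*$ and a covariant functor $M_*$ from ${}_G\mathrm{set}$ to sets with $M^*(X)=M_*(X)=:M(X)$ such that (a) $M^*$ sends finite coproducts to products; (b) for every pull-back square with $f\colon X\to Y$, $\eta\colon Y'\to Y$, $\xi\colon X'\to X$, $f'\colon X'\to Y'$ one has $M^*(\eta)M_*(f)=M_*(f')M^*(\xi)$. Each $M(X)$ is then a commutative monoid (operation $M_*(\nabla)$, $\nabla\colon X\amalg X\to X$ the folding map). It is a Mackey functor if all $M(X)$ are abelian groups. Exponential diagram of $X\overset{p}{\leftarrow}A$ and $f\colon X\to Y$: up to isomorphism, $\Pi=\{(y,\sigma)\mid y\in Y,\ \sigma\colon f^{-1}(y)\to A \text{ a map of sets},\ p\circ\sigma=\mathrm{id}\}$ with $G$-action by conjugating $\sigma$, $\pi\colon\Pi\to Y$, $\pi(y,\sigma)=y$, $Z=X\times_Y\Pi$, $\rho\colon Z\to\Pi$ the projection, $\lambda\colon Z\to A$, $\lambda(x,(y,\sigma))=\sigma(x)$.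 Tambara functor $T=(T^*,T_+,T_\bullet)$ on $G$: $T^*$ contravariant, $T_+,T_\bullet$ covariant functors ${}_G\mathrm{set}\to\mathrm{Set}$ such that $(T^*,T_+)$ is a Mackey functor, $(T^*,T_\bullet)$ is a semi-Mackey functor, and $T_\bullet(f)T_+(p)=T_+(\pi)T_\bullet(\rho)T^*(\lambda)$ for every exponential diagram. Each $T(X)$ is a ring. For $f\colon X\to Y$ write $f^*=T^*(f)$ (a ring homomorphism), $f_+=T_+(f)$ (additive), $f_\bullet=T_\bullet(f)$ (multiplicative). A morphism $\varphi\colon T\to S$ is a family of ring homomorphisms $\varphi_X\colon T(X)\to S(X)$ commuting with all $f^*,f_+,f_\bullet$. An ideal $\mathscr{I}$ of $T$ is a family of ideals $\mathscr{I}(X)\subseteq T(X)$ (for all finite $G$-sets $X$) such that for every $f\colon X\to Y$: (i) $f^*(\mathscr{I}(Y))\subseteq\mathscr{I}(X)$, (ii) $f_+(\mathscr{I}(X))\subseteq\mathscr{I}(Y)$, (iii) $f_\bullet(\mathscr{I}(X))\subseteq f_\bullet(0)+\mathscr{I}(Y)$. *)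

theory Defs
  imports "HOL-Algebra.Group_Action" "HOL-Algebra.Ideal" "HOL-Library.Infinite_Typeclass"
begin

section \<open>Finite G-sets\<close>

record ('g, 'u) gset =
  pts :: "'u set"
  act :: "'g \<Rightarrow> 'u \<Rightarrow> 'u"

definition fin_gset :: "('g, 'm) monoid_scheme \<Rightarrow> ('g, 'u) gset \<Rightarrow> bool" where
  "fin_gset G X \<longleftrightarrow> finite (pts X) \<and> group_action G (pts X) (act X)"

text \<open>Morphisms are extensional functions, so that two equivariant maps with the same source and
  target are equal as morphisms iff they are equal in HOL.\<close>

definition ghom :: "('g, 'm) monoid_scheme \<Rightarrow> ('g, 'a) gset \<Rightarrow> ('g, 'b) gset \<Rightarrow> ('a \<Rightarrow> 'b) set" where
  "ghom G X Y = {f \<in> pts X \<rightarrow>\<^sub>E pts Y.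
     \<forall>g\<in>carrier G. \<forall>x\<in>pts X. f (act X g x) = act Y g (f x)}"

definition giso :: "('g, 'm) monoid_scheme \<Rightarrow> ('g, 'a) gset \<Rightarrow> ('g, 'b) gset \<Rightarrow> ('a \<Rightarrow> 'b) set" where
  "giso G X Y = {f \<in> ghom G X Y. bij_betw f (pts X) (pts Y)}"

definition gid :: "('g, 'a) gset \<Rightarrow> 'a \<Rightarrow> 'a" where
  "gid X = (\<lambda>x\<in>pts X. x)"

abbreviation gcomp :: "('g, 'a) gset \<Rightarrow> ('b \<Rightarrow> 'c) \<Rightarrow> ('a \<Rightarrow> 'b) \<Rightarrow> 'a \<Rightarrow> 'c" where
  "gcomp X g f \<equiv> compose (pts X) g f"

text \<open>The category of finite G-sets is represented by the finite G-sets whose elements lie in an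
  arbitrary infinite type \<open>'u\<close>. Every finite G-set is isomorphic to one of these, so this is a
  category equivalent to that of all finite G-sets; in particular it has all finite coproducts,
  pull-backs and exponential diagrams.

  In the universal properties below all objects range over that category.\<close>

definition is_coproduct ::
  "('g, 'm) monoid_scheme \<Rightarrow> nat \<Rightarrow> (nat \<Rightarrow> ('g, 'u) gset) \<Rightarrow> ('g, 'u) gset \<Rightarrow> (nat \<Rightarrow> 'u \<Rightarrow> 'u) \<Rightarrow> bool"
where
  "is_coproduct G n X C \<iota> \<longleftrightarrow>
     (\<forall>k<n. fin_gset G (X k)) \<and> fin_gset G C \<and> (\<forall>k<n. \<iota> k \<in> ghom G (X k) C) \<and>
     (\<forall>(W :: ('g, 'u) gset) h. fin_gset G W \<and> (\<forall>k<n. h k \<in> ghom G (X k) W) \<longrightarrow>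
        (\<exists>!u. u \<in> ghom G C W \<and> (\<forall>k<n. gcomp (X k) u (\<iota> k) = h k)))"

text \<open>The square with sides \<open>f : X \<rightarrow> Y\<close>, \<open>\<eta> : Y' \<rightarrow> Y\<close>, \<open>\<xi> : X' \<rightarrow> X\<close>, \<open>f' : X' \<rightarrow> Y'\<close>.\<close>

definition is_pullback ::
  "('g, 'm) monoid_scheme \<Rightarrow> ('g, 'u) gset \<Rightarrow> ('g, 'u) gset \<Rightarrow> ('g, 'u) gset \<Rightarrow> ('g, 'u) gset \<Rightarrow>
   ('u \<Rightarrow> 'u) \<Rightarrow> ('u \<Rightarrow> 'u) \<Rightarrow> ('u \<Rightarrow> 'u) \<Rightarrow> ('u \<Rightarrow> 'u) \<Rightarrow> bool"
where
  "is_pullback G X Y X' Y' f \<eta> \<xi> f' \<longleftrightarrow>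
     fin_gset G X \<and> fin_gset G Y \<and> fin_gset G X' \<and> fin_gset G Y' \<and>
     f \<in> ghom G X Y \<and> \<eta> \<in> ghom G Y' Y \<and> \<xi> \<in> ghom G X' X \<and> f' \<in> ghom G X' Y' \<and>
     gcomp X' f \<xi> = gcomp X' \<eta> f' \<and>
     (\<forall>(W :: ('g, 'u) gset) a b.
        fin_gset G W \<and> a \<in> ghom G W X \<and> b \<in> ghom G W Y' \<and> gcomp W f a = gcomp W \<eta> b \<longrightarrow>
        (\<exists>!u. u \<in> ghom G W X' \<and> gcomp W \<xi> u = a \<and> gcomp W f' u = b))"

text \<open>The canonical exponential diagram
  \<open>X \<leftarrow> A \<leftarrow> X \<times>\<^sub>Y \<Pi> \<rightarrow> \<Pi> \<rightarrow> Y\<close> of \<open>p : A \<rightarrow> X\<close> and \<open>f : X \<rightarrow> Y\<close>. A pair \<open>(y, \<sigma>)\<close> in \<open>\<Pi>\<close> is moved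
  by \<open>g\<close> to \<open>(g y, x \<mapsto> g (\<sigma> (g\<inverse> x)))\<close>.\<close>

definition exp_fibre :: "('g, 'u) gset \<Rightarrow> ('u \<Rightarrow> 'u) \<Rightarrow> 'u \<Rightarrow> 'u set" where
  "exp_fibre X f y = {x \<in> pts X. f x = y}"

definition exp_Pi ::
  "('g, 'm) monoid_scheme \<Rightarrow> ('g, 'u) gset \<Rightarrow> ('g, 'u) gset \<Rightarrow> ('g, 'u) gset \<Rightarrow>
   ('u \<Rightarrow> 'u) \<Rightarrow> ('u \<Rightarrow> 'u) \<Rightarrow> ('g, 'u \<times> ('u \<Rightarrow> 'u)) gset"
where
  "exp_Pi G X A Y p f =
     (let P = {(y, \<sigma>). y \<in> pts Y \<and> \<sigma> \<in> exp_fibre X f y \<rightarrow>\<^sub>E pts A \<and>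
                       (\<forall>x\<in>exp_fibre X f y. p (\<sigma> x) = x)}
      in \<lparr>pts = P,
          act = (\<lambda>g. \<lambda>(y, \<sigma>)\<in>P. (act Y g y,
                   \<lambda>x\<in>exp_fibre X f (act Y g y). act A g (\<sigma> (act X (inv\<^bsub>G\<^esub> g) x))))\<rparr>)"

definition exp_Z ::
  "('g, 'm) monoid_scheme \<Rightarrow> ('g, 'u) gset \<Rightarrow> ('g, 'u) gset \<Rightarrow> ('g, 'u) gset \<Rightarrow>
   ('u \<Rightarrow> 'u) \<Rightarrow> ('u \<Rightarrow> 'u) \<Rightarrow> ('g, 'u \<times> ('u \<times> ('u \<Rightarrow> 'u))) gset"
where
  "exp_Z G X A Y p f =
     (let P = exp_Pi G X A Y p f; Q = {(x, q). x \<in> pts X \<and> q \<in> pts P \<and> f x = fst q}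
      in \<lparr>pts = Q, act = (\<lambda>g. \<lambda>(x, q)\<in>Q. (act X g x, act P g q))\<rparr>)"

definition is_exponential ::
  "('g, 'm) monoid_scheme \<Rightarrow> ('g, 'u) gset \<Rightarrow> ('g, 'u) gset \<Rightarrow> ('g, 'u) gset \<Rightarrow>
   ('g, 'u) gset \<Rightarrow> ('g, 'u) gset \<Rightarrow>
   ('u \<Rightarrow> 'u) \<Rightarrow> ('u \<Rightarrow> 'u) \<Rightarrow> ('u \<Rightarrow> 'u) \<Rightarrow> ('u \<Rightarrow> 'u) \<Rightarrow> ('u \<Rightarrow> 'u) \<Rightarrow> bool"
where
  "is_exponential G X A Y Z P p f l r q \<longleftrightarrow>
     fin_gset G X \<and> fin_gset G A \<and> fin_gset G Y \<and> fin_gset G Z \<and> fin_gset G P \<and>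
     p \<in> ghom G A X \<and> f \<in> ghom G X Y \<and> l \<in> ghom G Z A \<and> r \<in> ghom G Z P \<and> q \<in> ghom G P Y \<and>
     (\<exists>\<alpha> \<beta>. \<alpha> \<in> giso G P (exp_Pi G X A Y p f) \<and> \<beta> \<in> giso G Z (exp_Z G X A Y p f) \<and>
        (\<forall>w\<in>pts P. q w = fst (\<alpha> w)) \<and>
        (\<forall>z\<in>pts Z. \<alpha> (r z) = snd (\<beta> z)) \<and>
        (\<forall>z\<in>pts Z. l z = snd (snd (\<beta> z)) (fst (\<beta> z))))"


section \<open>Semi-Mackey and Mackey functors\<close>

locale semi_mackey_functor = group G for G (structure) +
  fixes M :: "('g, 'u::infinite) gset \<Rightarrow> 't set"
    and up :: "('g, 'u) gset \<Rightarrow> ('g, 'u) gset \<Rightarrow> ('u \<Rightarrow> 'u) \<Rightarrow> 't \<Rightarrow> 't"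
    and down :: "('g, 'u) gset \<Rightarrow> ('g, 'u) gset \<Rightarrow> ('u \<Rightarrow> 'u) \<Rightarrow> 't \<Rightarrow> 't"
  assumes finite_group: "finite (carrier G)"
    and up_closed: "\<lbrakk>fin_gset G X; fin_gset G Y; f \<in> ghom G X Y\<rbrakk> \<Longrightarrow> up X Y f \<in> M Y \<rightarrow> M X"
    and up_id: "\<lbrakk>fin_gset G X; m \<in> M X\<rbrakk> \<Longrightarrow> up X X (gid X) m = m"
    and up_comp: "\<lbrakk>fin_gset G X; fin_gset G Y; fin_gset G W; f \<in> ghom G X Y; h \<in> ghom G Y W; m \<in> M W\<rbrakk>
      \<Longrightarrow> up X W (gcomp X h f) m = up X Y f (up Y W h m)"
    and down_closed: "\<lbrakk>fin_gset G X; fin_gset G Y; f \<in> ghom G X Y\<rbrakk> \<Longrightarrow> down X Y f \<in> M X \<rightarrow> M Y"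
    and down_id: "\<lbrakk>fin_gset G X; m \<in> M X\<rbrakk> \<Longrightarrow> down X X (gid X) m = m"
    and down_comp: "\<lbrakk>fin_gset G X; fin_gset G Y; fin_gset G W; f \<in> ghom G X Y; h \<in> ghom G Y W; m \<in> M X\<rbrakk>
      \<Longrightarrow> down X W (gcomp X h f) m = down Y W h (down X Y f m)"
    and coproduct: "is_coproduct G n Xs C \<iota> \<Longrightarrow>
      bij_betw (\<lambda>m. \<lambda>k\<in>{..<n}. up (Xs k) C (\<iota> k) m) (M C) (\<Pi>\<^sub>E k\<in>{..<n}. M (Xs k))"
    and pullback: "\<lbrakk>is_pullback G X Y X' Y' f \<eta> \<xi> f'; m \<in> M X\<rbrakk>
      \<Longrightarrow> up Y' Y \<eta> (down X Y f m) = down X' Y' f' (up X' X \<xi> m)"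

text \<open>The operation \<open>M\<^sub>*(\<nabla>)\<close> on \<open>M(X)\<close>: \<open>a\<close>, \<open>b\<close> correspond to the element \<open>c\<close> of \<open>M(X \<amalg> X)\<close>
  restricting to \<open>a\<close> and \<open>b\<close> along the two inclusions, and \<open>\<nabla>\<close> (\<open>\<delta>\<close> below)
  restricts to the identity along both. The result does not depend on the coproduct used. The unit
  is the neutral element of this operation.\<close>

definition mackey_op ::
  "('g, 'm) monoid_scheme \<Rightarrow> (('g, 'u) gset \<Rightarrow> 't set) \<Rightarrow>
   (('g, 'u) gset \<Rightarrow> ('g, 'u) gset \<Rightarrow> ('u \<Rightarrow> 'u) \<Rightarrow> 't \<Rightarrow> 't) \<Rightarrow>
   (('g, 'u) gset \<Rightarrow> ('g, 'u) gset \<Rightarrow> ('u \<Rightarrow> 'u) \<Rightarrow> 't \<Rightarrow> 't) \<Rightarrow> ('g, 'u) gset \<Rightarrow> 't \<Rightarrow> 't \<Rightarrow> 't"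
where
  "mackey_op G M up down X a b =
     (THE s. \<exists>C \<iota> \<delta> c. is_coproduct G 2 (\<lambda>_. X) C \<iota> \<and>
        \<delta> \<in> ghom G C X \<and> gcomp X \<delta> (\<iota> 0) = gid X \<and> gcomp X \<delta> (\<iota> 1) = gid X \<and>
        c \<in> M C \<and> up X C (\<iota> 0) c = a \<and> up X C (\<iota> 1) c = b \<and> s = down C X \<delta> c)"

definition mackey_unit ::
  "('g, 'm) monoid_scheme \<Rightarrow> (('g, 'u) gset \<Rightarrow> 't set) \<Rightarrow>
   (('g, 'u) gset \<Rightarrow> ('g, 'u) gset \<Rightarrow> ('u \<Rightarrow> 'u) \<Rightarrow> 't \<Rightarrow> 't) \<Rightarrow>
   (('g, 'u) gset \<Rightarrow> ('g, 'u) gset \<Rightarrow> ('u \<Rightarrow> 'u) \<Rightarrow> 't \<Rightarrow> 't) \<Rightarrow> ('g, 'u) gset \<Rightarrow> 't"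
where
  "mackey_unit G M up down X =
     (THE e. e \<in> M X \<and>
        (\<forall>a\<in>M X. mackey_op G M up down X e a = a \<and> mackey_op G M up down X a e = a))"

definition mackey_monoid ::
  "('g, 'm) monoid_scheme \<Rightarrow> (('g, 'u) gset \<Rightarrow> 't set) \<Rightarrow>
   (('g, 'u) gset \<Rightarrow> ('g, 'u) gset \<Rightarrow> ('u \<Rightarrow> 'u) \<Rightarrow> 't \<Rightarrow> 't) \<Rightarrow>
   (('g, 'u) gset \<Rightarrow> ('g, 'u) gset \<Rightarrow> ('u \<Rightarrow> 'u) \<Rightarrow> 't \<Rightarrow> 't) \<Rightarrow> ('g, 'u) gset \<Rightarrow> 't monoid"
where
  "mackey_monoid G M up down X =
     \<lparr>carrier = M X, mult = mackey_op G M up down X, one = mackey_unit G M up down X\<rparr>"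

locale mackey_functor = semi_mackey_functor +
  assumes comm_group: "fin_gset G X \<Longrightarrow> comm_group (mackey_monoid G M up down X)"


section \<open>Tambara functors, morphisms and ideals\<close>

text \<open>\<open>res\<close>, \<open>tr\<close>, \<open>nrm\<close> are \<open>T\<^sup>*\<close>, \<open>T\<^sub>+\<close>, \<open>T\<^sub>\<bullet>\<close> on morphisms; the first two arguments are the
  source and the target of the morphism.\<close>

record ('g, 'u, 't) tambara =
  val :: "('g, 'u) gset \<Rightarrow> 't set"
  res :: "('g, 'u) gset \<Rightarrow> ('g, 'u) gset \<Rightarrow> ('u \<Rightarrow> 'u) \<Rightarrow> 't \<Rightarrow> 't"
  tr :: "('g, 'u) gset \<Rightarrow> ('g, 'u) gset \<Rightarrow> ('u \<Rightarrow> 'u) \<Rightarrow> 't \<Rightarrow> 't"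
  nrm :: "('g, 'u) gset \<Rightarrow> ('g, 'u) gset \<Rightarrow> ('u \<Rightarrow> 'u) \<Rightarrow> 't \<Rightarrow> 't"

locale tambara_functor =
  add: mackey_functor G "val T" "res T" "tr T" +
  mul: semi_mackey_functor G "val T" "res T" "nrm T"
  for G (structure) and T :: "('g, 'u::infinite, 't) tambara" +
  assumes exponential: "\<lbrakk>is_exponential G X A Y Z P p f l r q; a \<in> val T A\<rbrakk>
    \<Longrightarrow> nrm T X Y f (tr T A X p a) = tr T P Y q (nrm T Z P r (res T Z A l a))"

definition tambara_ring ::
  "('g, 'm) monoid_scheme \<Rightarrow> ('g, 'u, 't) tambara \<Rightarrow> ('g, 'u) gset \<Rightarrow> 't ring"
where
  "tambara_ring G T X =
     \<lparr>carrier = val T X,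
      mult = mackey_op G (val T) (res T) (nrm T) X,
      one = mackey_unit G (val T) (res T) (nrm T) X,
      zero = mackey_unit G (val T) (res T) (tr T) X,
      add = mackey_op G (val T) (res T) (tr T) X\<rparr>"

definition tambara_hom ::
  "('g, 'm) monoid_scheme \<Rightarrow> ('g, 'u, 't) tambara \<Rightarrow> ('g, 'u, 's) tambara \<Rightarrow>
   (('g, 'u) gset \<Rightarrow> 't \<Rightarrow> 's) \<Rightarrow> bool"
where
  "tambara_hom G T S \<phi> \<longleftrightarrow>
     (\<forall>X. fin_gset G X \<longrightarrow> \<phi> X \<in> ring_hom (tambara_ring G T X) (tambara_ring G S X)) \<and>
     (\<forall>X Y f. fin_gset G X \<and> fin_gset G Y \<and> f \<in> ghom G X Y \<longrightarrow>
        (\<forall>b\<in>val T Y. \<phi> X (res T X Y f b) = res S X Y f (\<phi> Y b)) \<and>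
        (\<forall>a\<in>val T X. \<phi> Y (tr T X Y f a) = tr S X Y f (\<phi> X a)) \<and>
        (\<forall>a\<in>val T X. \<phi> Y (nrm T X Y f a) = nrm S X Y f (\<phi> X a)))"

definition tambara_ideal ::
  "('g, 'm) monoid_scheme \<Rightarrow> ('g, 'u, 't) tambara \<Rightarrow> (('g, 'u) gset \<Rightarrow> 't set) \<Rightarrow> bool"
where
  "tambara_ideal G T I \<longleftrightarrow>
     (\<forall>X. fin_gset G X \<longrightarrow> ideal (I X) (tambara_ring G T X)) \<and>
     (\<forall>X Y f. fin_gset G X \<and> fin_gset G Y \<and> f \<in> ghom G X Y \<longrightarrow>
        res T X Y f ` I Y \<subseteq> I X \<and>
        tr T X Y f ` I X \<subseteq> I Y \<and>
        nrm T X Y f ` I X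
          \<subseteq> nrm T X Y f \<zero>\<^bsub>tambara_ring G T X\<^esub> <+\<^bsub>tambara_ring G T Y\<^esub> I Y)"

definition tambara_ker ::
  "('g, 'm) monoid_scheme \<Rightarrow> ('g, 'u, 't) tambara \<Rightarrow> ('g, 'u, 's) tambara \<Rightarrow>
   (('g, 'u) gset \<Rightarrow> 't \<Rightarrow> 's) \<Rightarrow> ('g, 'u) gset \<Rightarrow> 't set"
where
  "tambara_ker G T S \<phi> X = a_kernel (tambara_ring G T X) (tambara_ring G S X) (\<phi> X)"

end

theory Submission
  imports Defs "HOL-Library.Countable_Set" "HOL-Algebra.RingHom"
begin

text \<open>A morphism commutes with restrictions and transfers, which preserve zero, and if \<open>\<phi>(a) = 0\<close>
  then \<open>f\<^sub>\<bullet>(a) - f\<^sub>\<bullet>(0)\<close> is killed by \<open>\<phi>\<close>. What takes work is that each \<open>T(X)\<close> is a ring. The monoid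
  laws come from base change along folding maps \<open>n \<cdot> X \<rightarrow> X\<close>, with the empty coproduct giving the
  unit, and distributivity \<open>a (b + c) = a b + a c\<close> is the exponential formula for
  \<open>X \<amalg> X \<amalg> X \<rightarrow> X \<amalg> X \<rightarrow> X\<close>, where \<open>\<Pi> = X \<amalg> X\<close> records which of \<open>b\<close>, \<open>c\<close> is chosen.\<close>

subsection \<open>Finite G-sets\<close>

text \<open>Of the ring laws, the definition supplies only the additive ones; the multiplicative
  monoid and distributivity have to be extracted from functoriality, base change and the exponential
  formula. Addition and multiplication are one construction applied to \<open>tr\<close> and to
  \<open>nrm\<close>, so the monoid laws are proved once, for an arbitrary semi-Mackey functor.

  The operation is a definite description ranging over all coproducts of X with itself, so its value
  must first be shown independent of the coproduct. After that everything is computed in disjoint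
  unions whose points are known; these must be built inside the fixed infinite type of points.

  The final step compares a norm with the norm of 0 because a norm need not kill 0: over an empty
  fibre it is an empty product, hence 1 whatever the argument.\<close>

lemma act_closed:
  assumes "fin_gset G X" "g \<in> carrier G" "x \<in> pts X"
  shows "act X g x \<in> pts X"
  using assms group_action.element_image unfolding fin_gset_def by fastforce

lemma act_inv:
  assumes "fin_gset G X" "g \<in> carrier G" "x \<in> pts X"
  shows "act X (inv\<^bsub>G\<^esub> g) (act X g x) = x" "act X g (act X (inv\<^bsub>G\<^esub> g) x) = x"
proof -
  interpret group_action G "pts X" "act X" using assms fin_gset_def by blast
  interpret group G using group_hom group_hom.axioms(1) by blast
  have *: "act X (inv\<^bsub>G\<^esub> h) (act X h x) = x" if "h \<in> carrier G" for h
    using orbit_sym_aux[OF that assms(3)] by blast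
  show "act X (inv\<^bsub>G\<^esub> g) (act X g x) = x" using *[OF assms(2)] .
  show "act X g (act X (inv\<^bsub>G\<^esub> g) x) = x"
    using *[of "inv\<^bsub>G\<^esub> g"] assms(2) by simp
qed

lemma ghom_closed: "f \<in> ghom G X Y \<Longrightarrow> x \<in> pts X \<Longrightarrow> f x \<in> pts Y"
  by (auto simp: ghom_def)

lemma ghom_act:
  "f \<in> ghom G X Y \<Longrightarrow> g \<in> carrier G \<Longrightarrow> x \<in> pts X \<Longrightarrow> f (act X g x) = act Y g (f x)"
  by (auto simp: ghom_def)

lemma ghom_eqI:
  "f \<in> ghom G X Y \<Longrightarrow> h \<in> ghom G X W \<Longrightarrow> (\<And>x. x \<in> pts X \<Longrightarrow> f x = h x) \<Longrightarrow> f = h"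
  unfolding ghom_def by (auto intro: extensionalityI[of _ "pts X"] simp: PiE_def)

lemma gid_ghom: "fin_gset G X \<Longrightarrow> gid X \<in> ghom G X X"
  by (auto simp: ghom_def gid_def act_closed)

lemma gid_apply: "x \<in> pts X \<Longrightarrow> gid X x = x"
  by (simp add: gid_def)

lemma gcomp_ghom:
  assumes "fin_gset G X" "f \<in> ghom G X Y" "h \<in> ghom G Y W"
  shows "gcomp X h f \<in> ghom G X W"
proof -
  have "h (f (act X g x)) = act W g (h (f x))" if "g \<in> carrier G" "x \<in> pts X" for g x
    using that ghom_act[OF assms(2)] ghom_act[OF assms(3)] ghom_closed[OF assms(2)] by simp
  then show ?thesis
    using assms(1) ghom_closed[OF assms(2)] ghom_closed[OF assms(3)]
    by (auto simp: ghom_def[of G X W] compose_def act_closed)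
qed

lemma gcomp_eqI:
  assumes "fin_gset G X" "f \<in> ghom G X Y" "h \<in> ghom G Y W" "k \<in> ghom G X W"
    and "\<And>x. x \<in> pts X \<Longrightarrow> h (f x) = k x"
  shows "gcomp X h f = k"
  by (rule ghom_eqI[OF gcomp_ghom[OF assms(1-3)] assms(4)]) (simp add: assms compose_eq)

lemma gcomp_eqD: "gcomp X h f = k \<Longrightarrow> x \<in> pts X \<Longrightarrow> h (f x) = k x"
  by (metis compose_eq)

text \<open>Since limits of G-sets are computed on points, it suffices to test the universal property
  against points.\<close>

lemma pullbackI:
  fixes X Y X' Y' :: "('g, 'u) gset"
  assumes fin: "fin_gset G X" "fin_gset G Y" "fin_gset G X'" "fin_gset G Y'"
    and hom: "f \<in> ghom G X Y" "\<eta> \<in> ghom G Y' Y" "\<xi> \<in> ghom G X' X" "f' \<in> ghom G X' Y'"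
    and comm: "\<And>x. x \<in> pts X' \<Longrightarrow> f (\<xi> x) = \<eta> (f' x)"
    and ex: "\<And>x y. x \<in> pts X \<Longrightarrow> y \<in> pts Y' \<Longrightarrow> f x = \<eta> y \<Longrightarrow> \<exists>z\<in>pts X'. \<xi> z = x \<and> f' z = y"
    and uniq: "\<And>z w. z \<in> pts X' \<Longrightarrow> w \<in> pts X' \<Longrightarrow> \<xi> z = \<xi> w \<Longrightarrow> f' z = f' w \<Longrightarrow> z = w"
  shows "is_pullback G X Y X' Y' f \<eta> \<xi> f'"
  unfolding is_pullback_def
proof (intro conjI allI impI fin hom)
  show "gcomp X' f \<xi> = gcomp X' \<eta> f'"
    using comm by (auto simp: compose_def)
  fix W :: "('g, 'u) gset" and a b
  assume W: "fin_gset G W \<and> a \<in> ghom G W X \<and> b \<in> ghom G W Y' \<and> gcomp W f a = gcomp W \<eta> b"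
  have eq: "f (a w) = \<eta> (b w)" if "w \<in> pts W" for w
    using W that by (metis compose_eq)
  have "\<exists>z\<in>pts X'. \<xi> z = a w \<and> f' z = b w" if "w \<in> pts W" for w
    using W that eq by (intro ex) (auto simp: ghom_closed)
  then obtain v where v: "\<And>w. w \<in> pts W \<Longrightarrow> v w \<in> pts X' \<and> \<xi> (v w) = a w \<and> f' (v w) = b w"
    by metis
  define u where "u = restrict v (pts W)"
  have u: "u \<in> ghom G W X'"
    unfolding ghom_def
  proof (intro CollectI conjI ballI)
    show "u \<in> pts W \<rightarrow>\<^sub>E pts X'" using v by (auto simp: u_def)
    fix g w assume g: "g \<in> carrier G" and w: "w \<in> pts W"
    have gw: "act W g w \<in> pts W" using W g w by (auto simp: act_closed)
    show "u (act W g w) = act X' g (u w)"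
    \<comment> \<open>The chosen lift is automatically equivariant: both sides have the same two
      projections, and a point of the corner is determined by these.\<close>
    proof (rule uniq)
      show "u (act W g w) \<in> pts X'" "act X' g (u w) \<in> pts X'"
        using v w gw g fin by (auto simp: u_def act_closed)
      show "\<xi> (u (act W g w)) = \<xi> (act X' g (u w))"
        using v w gw g W hom ghom_act[of a G W X] ghom_act[of \<xi> G X' X] by (auto simp: u_def)
      show "f' (u (act W g w)) = f' (act X' g (u w))"
        using v w gw g W hom ghom_act[of b G W Y'] ghom_act[of f' G X' Y'] by (auto simp: u_def)
    qed
  qed
  show "\<exists>!u. u \<in> ghom G W X' \<and> gcomp W \<xi> u = a \<and> gcomp W f' u = b"
  proof (rule ex1I[of _ u])
    show "u \<in> ghom G W X' \<and> gcomp W \<xi> u = a \<and> gcomp W f' u = b"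
      using W hom v u gcomp_eqI[of G W u X' \<xi> X a] gcomp_eqI[of G W u X' f' Y' b]
      by (auto simp: u_def)
    fix u' assume u': "u' \<in> ghom G W X' \<and> gcomp W \<xi> u' = a \<and> gcomp W f' u' = b"
    show "u' = u"
    proof (rule ghom_eqI[of _ G W X'])
      fix w assume w: "w \<in> pts W"
      have "\<xi> (u' w) = a w" "f' (u' w) = b w"
        using u' w gcomp_eqD[of W \<xi> u' a w] gcomp_eqD[of W f' u' b w] by blast+
      moreover have "u' w \<in> pts X'" "u w \<in> pts X'" "u w = v w"
        using u' u w ghom_closed[of u' G W X' w] ghom_closed[of u G W X' w] by (simp_all add: u_def)
      ultimately show "u' w = u w"
        using v[OF w] uniq[of "u' w" "u w"] by simp
    qed (use u u' in auto)
  qed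
qed

lemma coproduct_ex1:
  fixes C W :: "('g, 'u) gset"
  assumes "is_coproduct G n X C \<iota>" "fin_gset G W" "\<forall>k<n. h k \<in> ghom G (X k) W"
  shows "\<exists>!u. u \<in> ghom G C W \<and> (\<forall>k<n. gcomp (X k) u (\<iota> k) = h k)"
  by (rule assms(1)[unfolded is_coproduct_def, THEN conjunct2, THEN conjunct2, THEN conjunct2,
    THEN spec, THEN spec, THEN mp, OF conjI[OF assms(2,3)]])

lemma coproduct_ghom:
  fixes C W :: "('g, 'u) gset"
  assumes cop: "is_coproduct G n X C \<iota>" and "fin_gset G W" "\<And>k. k < n \<Longrightarrow> h k \<in> ghom G (X k) W"
  shows "\<exists>u\<in>ghom G C W. \<forall>k<n. \<forall>x\<in>pts (X k). u (\<iota> k x) = h k x"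
proof -
  obtain u where u: "u \<in> ghom G C W" "\<forall>k<n. gcomp (X k) u (\<iota> k) = h k"
    using coproduct_ex1[OF assms(1,2)] assms(3) by metis
  then have "u (\<iota> k x) = h k x" if "k < n" "x \<in> pts (X k)" for k x
    using that gcomp_eqD[of "X k" u "\<iota> k" "h k" x] by blast
  with u(1) show ?thesis by blast
qed

text \<open>The injections of a coproduct are jointly epic. This replaces case distinction on
  points, which an abstract coproduct, known only by its universal property, does not offer
  directly.\<close>

lemma coproduct_ghom_eq:
  fixes C W :: "('g, 'u) gset"
  assumes cop: "is_coproduct G n X C \<iota>" and W: "fin_gset G W"
    and u: "u \<in> ghom G C W" and v: "v \<in> ghom G C W"
    and eq: "\<And>k x. k < n \<Longrightarrow> x \<in> pts (X k) \<Longrightarrow> u (\<iota> k x) = v (\<iota> k x)"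
  shows "u = v"
proof -
  have \<iota>: "\<And>k. k < n \<Longrightarrow> fin_gset G (X k)" "\<And>k. k < n \<Longrightarrow> \<iota> k \<in> ghom G (X k) C"
    using cop unfolding is_coproduct_def by blast+
  have "\<forall>k<n. gcomp (X k) v (\<iota> k) \<in> ghom G (X k) W"
    using gcomp_ghom[OF \<iota> v] by blast
  from coproduct_ex1[OF cop W this]
  have "\<exists>!u. u \<in> ghom G C W \<and> (\<forall>k<n. gcomp (X k) u (\<iota> k) = gcomp (X k) v (\<iota> k))" .
  moreover have "\<forall>k<n. gcomp (X k) u (\<iota> k) = gcomp (X k) v (\<iota> k)"
    using eq by (auto simp: compose_def)
  ultimately show ?thesis using u v by blast
qed


subsection \<open>Disjoint unions\<close>

text \<open>The concrete counterpart of \<open>is_coproduct\<close>: every point has a unique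
  summand and preimage there, so fibres can be inspected and the pull-back squares below verified
  pointwise.\<close>

definition disjoint_union ::
  "('g, 'm) monoid_scheme \<Rightarrow> nat \<Rightarrow> (nat \<Rightarrow> ('g, 'u) gset) \<Rightarrow> ('g, 'u) gset \<Rightarrow> (nat \<Rightarrow> 'u \<Rightarrow> 'u) \<Rightarrow> bool"
where
  "disjoint_union G n X C \<iota> \<longleftrightarrow>
     (\<forall>k<n. fin_gset G (X k)) \<and> fin_gset G C \<and> (\<forall>k<n. \<iota> k \<in> ghom G (X k) C) \<and>
     bij_betw (\<lambda>(k, x). \<iota> k x) (SIGMA k:{..<n}. pts (X k)) (pts C)"

lemma disjoint_unionD:
  assumes "disjoint_union G n X C \<iota>"
  shows "fin_gset G C" "\<And>k. k < n \<Longrightarrow> fin_gset G (X k)" "\<And>k. k < n \<Longrightarrow> \<iota> k \<in> ghom G (X k) C"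
    "\<And>k x. k < n \<Longrightarrow> x \<in> pts (X k) \<Longrightarrow> \<iota> k x \<in> pts C"
  using assms by (auto simp: disjoint_union_def ghom_closed)

lemma disjoint_unionI:
  assumes "\<And>k. k < n \<Longrightarrow> fin_gset G (X k)" "fin_gset G C" "\<And>k. k < n \<Longrightarrow> \<iota> k \<in> ghom G (X k) C"
    and "\<And>j k x y. j < n \<Longrightarrow> k < n \<Longrightarrow> x \<in> pts (X j) \<Longrightarrow> y \<in> pts (X k) \<Longrightarrow> \<iota> j x = \<iota> k y \<Longrightarrow>
      j = k \<and> x = y"
    and "\<And>c. c \<in> pts C \<Longrightarrow> \<exists>k<n. \<exists>x\<in>pts (X k). c = \<iota> k x"
  shows "disjoint_union G n X C \<iota>"
  unfolding disjoint_union_def bij_betw_def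
proof (intro conjI)
  show "inj_on (\<lambda>(k, x). \<iota> k x) (SIGMA k:{..<n}. pts (X k))"
  proof (rule inj_onI)
    fix z w assume "z \<in> (SIGMA k:{..<n}. pts (X k))" "w \<in> (SIGMA k:{..<n}. pts (X k))"
      "(case z of (k, x) \<Rightarrow> \<iota> k x) = (case w of (k, x) \<Rightarrow> \<iota> k x)"
    then show "z = w" using assms(4)[of "fst z" "fst w" "snd z" "snd w"] by auto
  qed
  show "(\<lambda>(k, x). \<iota> k x) ` (SIGMA k:{..<n}. pts (X k)) = pts C"
    using assms(5) ghom_closed[OF assms(3)] by fastforce
qed (use assms(1-3) in blast)+

lemma disjoint_union_cases:
  assumes "disjoint_union G n X C \<iota>" "c \<in> pts C"
  obtains k x where "k < n" "x \<in> pts (X k)" "c = \<iota> k x"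
proof -
  have "(\<lambda>(k, x). \<iota> k x) ` (SIGMA k:{..<n}. pts (X k)) = pts C"
    using assms(1) by (simp add: disjoint_union_def bij_betw_def)
  with assms(2) show ?thesis using that by fastforce
qed

lemma disjoint_union_eq_iff:
  assumes "disjoint_union G n X C \<iota>" "j < n" "k < n" "x \<in> pts (X j)" "y \<in> pts (X k)"
  shows "\<iota> j x = \<iota> k y \<longleftrightarrow> j = k \<and> x = y"
proof -
  have "inj_on (\<lambda>(k, x). \<iota> k x) (SIGMA k:{..<n}. pts (X k))"
    using assms(1) by (simp add: disjoint_union_def bij_betw_def)
  from inj_on_eq_iff[OF this, of "(j, x)" "(k, y)"] show ?thesis
    using assms by auto
qed

text \<open>Unlike in \<open>is_coproduct\<close>, the target may have points of any type. The maps
  into \<open>exp_Pi\<close> and \<open>exp_Z\<close>, which live outside the type of the category,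
  rely on this.\<close>

lemma disjoint_union_ghom:
  assumes du: "disjoint_union G n X C \<iota>" and h: "\<And>k. k < n \<Longrightarrow> h k \<in> ghom G (X k) W"
  shows "\<exists>u\<in>ghom G C W. \<forall>k<n. \<forall>x\<in>pts (X k). u (\<iota> k x) = h k x"
proof -
  define u where
    "u = (\<lambda>c\<in>pts C. case the_inv_into (SIGMA k:{..<n}. pts (X k)) (\<lambda>(k, x). \<iota> k x) c of (k, x) \<Rightarrow> h k x)"
  have *: "u (\<iota> k x) = h k x" if "k < n" "x \<in> pts (X k)" for k x
  proof -
    have "the_inv_into (SIGMA k:{..<n}. pts (X k)) (\<lambda>(k, x). \<iota> k x) ((\<lambda>(k, x). \<iota> k x) (k, x)) = (k, x)"
      using du that by (intro the_inv_into_f_f) (auto simp: disjoint_union_def bij_betw_def)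
    then show ?thesis using that disjoint_unionD(4)[OF du that] by (simp add: u_def)
  qed
  have "u \<in> ghom G C W"
    unfolding ghom_def
  proof (intro CollectI conjI ballI PiE_I)
    fix c assume "c \<in> pts C"
    then show "u c \<in> pts W"
      using * ghom_closed[OF h] by (auto elim!: disjoint_union_cases[OF du])
  next
    fix g c assume g: "g \<in> carrier G" and "c \<in> pts C"
    then obtain k x where k: "k < n" "x \<in> pts (X k)" "c = \<iota> k x"
      using du by (blast elim: disjoint_union_cases)
    have "act C g c = \<iota> k (act (X k) g x)"
      using ghom_act[OF disjoint_unionD(3)[OF du k(1)] g k(2)] k by simp
    then show "u (act C g c) = act W g (u c)"
      using k g ghom_act[OF h[OF k(1)] g k(2)] act_closed[OF disjoint_unionD(2)[OF du k(1)] g k(2)]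
      by (simp add: *)
  qed (simp add: u_def)
  then show ?thesis using * by blast
qed

text \<open>The source of symmetry: relabelling the injections keeps \<open>C\<close>, its elements
  and the folding map, and only reorders the operands of the operation.\<close>

lemma disjoint_union_permute:
  assumes du: "disjoint_union G n (\<lambda>_. X) C \<iota>" and \<pi>: "bij_betw \<pi> {..<n} {..<n}"
  shows "disjoint_union G n (\<lambda>_. X) C (\<lambda>k. \<iota> (\<pi> k))"
proof (rule disjoint_unionI)
  have \<pi>_less: "\<pi> k < n" if "k < n" for k
    using bij_betwE[OF \<pi>] that by auto
  show "\<iota> (\<pi> k) \<in> ghom G X C" if "k < n" for k
    using disjoint_unionD(3)[OF du] \<pi>_less that by blast
  show "j = k \<and> x = y"
    if "j < n" "k < n" "x \<in> pts X" "y \<in> pts X" "\<iota> (\<pi> j) x = \<iota> (\<pi> k) y" for j k x y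
    using that disjoint_union_eq_iff[OF du \<pi>_less \<pi>_less] bij_betw_imp_inj_on[OF \<pi>]
    by (auto dest: inj_onD)
  fix c assume "c \<in> pts C"
  then obtain k x where "k < n" "x \<in> pts X" "c = \<iota> k x"
    by (blast elim: disjoint_union_cases[OF du])
  moreover from this obtain j where "j < n" "k = \<pi> j"
    using bij_betw_imp_surj_on[OF \<pi>] by (metis imageE lessThan_iff)
  ultimately show "\<exists>k<n. \<exists>x\<in>pts X. c = \<iota> (\<pi> k) x" by blast
qed (use disjoint_unionD[OF du] in auto)

lemma disjoint_union_fold:
  assumes C: "disjoint_union G n (\<lambda>_. X) C \<iota>" and X: "fin_gset G X"
  shows "\<exists>\<delta>\<in>ghom G C X. \<forall>k<n. \<forall>x\<in>pts X. \<delta> (\<iota> k x) = x"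
  using disjoint_union_ghom[OF C gid_ghom[OF X]] by (simp add: gid_apply)

lemma disjoint_union_is_coproduct:
  fixes C :: "('g, 'u) gset"
  assumes du: "disjoint_union G n X C \<iota>"
  shows "is_coproduct G n X C \<iota>"
  unfolding is_coproduct_def
proof (intro conjI allI impI)
  fix W :: "('g, 'u) gset" and h
  assume W: "fin_gset G W \<and> (\<forall>k<n. h k \<in> ghom G (X k) W)"
  then obtain u where u: "u \<in> ghom G C W" "\<And>k x. k < n \<Longrightarrow> x \<in> pts (X k) \<Longrightarrow> u (\<iota> k x) = h k x"
    using disjoint_union_ghom[OF du, of h W] by auto
  show "\<exists>!u. u \<in> ghom G C W \<and> (\<forall>k<n. gcomp (X k) u (\<iota> k) = h k)"
  proof (rule ex1I[of _ u])
    show "u \<in> ghom G C W \<and> (\<forall>k<n. gcomp (X k) u (\<iota> k) = h k)"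
      using u W disjoint_unionD[OF du] by (auto intro!: gcomp_eqI)
    fix v assume v: "v \<in> ghom G C W \<and> (\<forall>k<n. gcomp (X k) v (\<iota> k) = h k)"
    have "v (\<iota> k x) = u (\<iota> k x)" if "k < n" "x \<in> pts (X k)" for k x
      using v that u(2)[OF that] gcomp_eqD[of "X k" v "\<iota> k" "h k" x] by auto
    then show "v = u"
      using u v by (intro ghom_eqI[of v G C W]) (auto elim!: disjoint_union_cases[OF du])
  qed
qed (use du in \<open>auto simp: disjoint_union_def\<close>)

text \<open>The tagged sum of the summands has the wrong type, but it is finite, so it can be
  numbered and then copied into the infinite type through an injection from the naturals. The action
  is transported along this coding.\<close>

lemma ex_disjoint_union:
  fixes X :: "nat \<Rightarrow> ('g, 'u::infinite) gset"
  assumes "group G" and X: "\<And>k. k < n \<Longrightarrow> fin_gset G (X k)"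
  obtains C \<iota> where "disjoint_union G n X C \<iota>"
proof -
  interpret group G by fact
  define D where "D = (SIGMA k:{..<n}. pts (X k))"
  have "finite D" using X by (auto simp: D_def fin_gset_def)
  obtain j :: "nat \<Rightarrow> 'u" where j: "inj j"
    using infinite_countable_subset[OF infinite_UNIV] by blast
  define e where "e = j \<circ> to_nat_on D"
  have e: "inj_on e D"
    unfolding e_def using \<open>finite D\<close> j
    by (intro comp_inj_on inj_on_to_nat_on countable_finite) (auto intro: inj_on_subset)
  define d where "d = the_inv_into D e"
  have de: "d (e z) = z" if "z \<in> D" for z
    using e that by (simp add: d_def the_inv_into_f_f)
  \<comment> \<open>The action is restricted to the coded points because the elements of
    \<open>BijGroup\<close> are extensional functions.\<close>
  define C where "C = \<lparr>pts = e ` D,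
    act = (\<lambda>g. \<lambda>c\<in>e ` D. e (fst (d c), act (X (fst (d c))) g (snd (d c))))\<rparr>"
  have pts: "pts C = e ` D" by (simp add: C_def)
  have act: "act C g (e (k, x)) = e (k, act (X k) g x)" if "(k, x) \<in> D" for g k x
    using that by (simp add: C_def de)
  have cl: "(k, act (X k) g x) \<in> D" if "(k, x) \<in> D" "g \<in> carrier G" for g k x
    using that act_closed[OF X] by (auto simp: D_def)
  have inv: "act C (inv\<^bsub>G\<^esub> g) (act C g c) = c" "act C g (act C (inv\<^bsub>G\<^esub> g) c) = c"
    if c: "c \<in> pts C" and g: "g \<in> carrier G" for c g
  proof -
    obtain k x where kx: "(k, x) \<in> D" "c = e (k, x)" using c by (auto simp: pts)
    then have "fin_gset G (X k)" "x \<in> pts (X k)" using X by (auto simp: D_def)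
    then show "act C (inv\<^bsub>G\<^esub> g) (act C g c) = c" "act C g (act C (inv\<^bsub>G\<^esub> g) c) = c"
      using kx g by (simp_all add: act cl act_inv)
  qed
  have closed: "act C g c \<in> pts C" if "c \<in> pts C" "g \<in> carrier G" for c g
    using that cl act by (auto simp: pts)
  have "group_action G (pts C) (act C)"
    unfolding group_action_def group_hom_def group_hom_axioms_def
  proof (intro conjI group_BijGroup homI)
    show "group G" by fact
    show bij: "act C g \<in> carrier (BijGroup (pts C))" if "g \<in> carrier G" for g
    proof -
      have "bij_betw (act C g) (pts C) (pts C)"
        using that by (intro bij_betw_byWitness[where f' = "act C (inv\<^bsub>G\<^esub> g)"])
          (auto simp: inv closed)
      moreover have "act C g \<in> extensional (pts C)" by (simp add: C_def)
      ultimately show ?thesis by (simp add: BijGroup_def Bij_def)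
    qed
    fix g h assume gh: "g \<in> carrier G" "h \<in> carrier G"
    have "act C (g \<otimes>\<^bsub>G\<^esub> h) c = act C g (act C h c)" if c: "c \<in> pts C" for c
    proof -
      obtain k x where kx: "(k, x) \<in> D" "c = e (k, x)" using c by (auto simp: pts)
      interpret X: group_action G "pts (X k)" "act (X k)"
        using kx X by (auto simp: D_def fin_gset_def)
      have "act (X k) (g \<otimes>\<^bsub>G\<^esub> h) x = act (X k) g (act (X k) h x)"
        using kx gh X.composition_rule[of x g h] by (simp add: D_def)
      then show ?thesis using kx gh by (simp add: act cl)
    qed
    moreover have "act C (g \<otimes>\<^bsub>G\<^esub> h) \<in> extensional (pts C)" by (simp add: C_def)
    ultimately have "act C (g \<otimes>\<^bsub>G\<^esub> h) = compose (pts C) (act C g) (act C h)"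
      by (intro extensionalityI[of _ "pts C"]) (auto simp: compose_eq)
    then show "act C (g \<otimes>\<^bsub>G\<^esub> h) = act C g \<otimes>\<^bsub>BijGroup (pts C)\<^esub> act C h"
      using bij[OF gh(1)] bij[OF gh(2)] by (simp add: BijGroup_def)
  qed
  then have "fin_gset G C"
    using \<open>finite D\<close> by (simp add: fin_gset_def pts)
  then have "disjoint_union G n X C (\<lambda>k. \<lambda>x\<in>pts (X k). e (k, x))"
    unfolding disjoint_union_def
  proof (intro conjI allI impI X)
    show "(\<lambda>x\<in>pts (X k). e (k, x)) \<in> ghom G (X k) C" if "k < n" for k
      using that act_closed[OF X[OF that]] act by (auto simp: ghom_def pts D_def)
    have "bij_betw e D (pts C)" using e by (simp add: bij_betw_def pts)
    then show "bij_betw (\<lambda>(k, y). (\<lambda>x\<in>pts (X k). e (k, x)) y) (SIGMA k:{..<n}. pts (X k)) (pts C)"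
      by (subst bij_betw_cong[where g = e]) (auto simp: D_def)
  qed
  then show ?thesis using that by blast
qed


lemma ex_copies:
  fixes X :: "('g, 'u::infinite) gset"
  assumes "group G" and X: "fin_gset G X"
  obtains C \<iota> \<delta> where "disjoint_union G n (\<lambda>_. X) C \<iota>" "\<delta> \<in> ghom G C X"
    "\<And>k x. k < n \<Longrightarrow> x \<in> pts X \<Longrightarrow> \<delta> (\<iota> k x) = x"
proof -
  obtain C \<iota> where C: "disjoint_union G n (\<lambda>_. X) C \<iota>"
    by (rule ex_disjoint_union[OF assms])
  obtain \<delta> where "\<delta> \<in> ghom G C X" "\<forall>k<n. \<forall>x\<in>pts X. \<delta> (\<iota> k x) = x"
    using disjoint_union_fold[OF C X] by (rule bexE)
  with C show ?thesis using that[of C \<iota> \<delta>] by auto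
qed


subsection \<open>The monoid structure of a semi-Mackey functor\<close>

context semi_mackey_functor
begin

section \<open>Base change and gluing in a semi-Mackey functor\<close>

lemma up_in: "fin_gset G X \<Longrightarrow> fin_gset G Y \<Longrightarrow> f \<in> ghom G X Y \<Longrightarrow> m \<in> M Y \<Longrightarrow> up X Y f m \<in> M X"
  using up_closed by blast

lemma down_in: "fin_gset G X \<Longrightarrow> fin_gset G Y \<Longrightarrow> f \<in> ghom G X Y \<Longrightarrow> m \<in> M X \<Longrightarrow> down X Y f m \<in> M Y"
  using down_closed by blast

lemma up_up:
  assumes "fin_gset G X" "fin_gset G Y" "fin_gset G W" "f \<in> ghom G X Y" "h \<in> ghom G Y W"
    "k \<in> ghom G X W" "\<And>x. x \<in> pts X \<Longrightarrow> h (f x) = k x" "m \<in> M W"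
  shows "up X Y f (up Y W h m) = up X W k m"
  using up_comp[of X Y W f h m] gcomp_eqI[of G X f Y h W k] assms by simp

lemma down_down:
  assumes "fin_gset G X" "fin_gset G Y" "fin_gset G W" "f \<in> ghom G X Y" "h \<in> ghom G Y W"
    "k \<in> ghom G X W" "\<And>x. x \<in> pts X \<Longrightarrow> h (f x) = k x" "m \<in> M X"
  shows "down Y W h (down X Y f m) = down X W k m"
  using down_comp[of X Y W f h m] gcomp_eqI[of G X f Y h W k] assms by simp

text \<open>Base change for a square that is checked on points. Each restriction of a pushed-forward
  element below is evaluated by choosing the corner of such a square.\<close>

lemmas up_down = pullback[OF pullbackI]

text \<open>If u is invertible, the square with two sides u and two sides the identity of
  \<open>D\<close> is a pull-back, and base change along it is the claim.\<close>

lemma down_up_iso: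
  assumes fin: "fin_gset G C" "fin_gset G D" and hom: "u \<in> ghom G C D" "v \<in> ghom G D C"
    and inv: "\<And>c. c \<in> pts C \<Longrightarrow> v (u c) = c" "\<And>d. d \<in> pts D \<Longrightarrow> u (v d) = d"
    and m: "m \<in> M D"
  shows "down C D u (up C D u m) = m"
proof -
  have "up D D (gid D) (down D D (gid D) m) = down C D u (up C D u m)"
  proof (rule up_down)
    show "\<exists>z\<in>pts C. u z = x \<and> u z = y"
      if "x \<in> pts D" "y \<in> pts D" "gid D x = gid D y" for x y
      using that inv ghom_closed[OF hom(2)] by (auto simp: gid_apply intro!: bexI[of _ "v x"])
    show "z = w" if "z \<in> pts C" "w \<in> pts C" "u z = u w" for z w
      using that inv by metis
  qed (use assms gid_ghom in \<open>auto simp: gid_apply ghom_closed\<close>)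
  then show ?thesis using fin m by (simp add: up_id down_id)
qed

text \<open>For n = 0 this says that the value at the empty G-set has at most one element;
  \<open>mackey_op_initial\<close> uses it in this form.\<close>

lemma coproduct_inj:
  assumes "is_coproduct G n Xs C \<iota>" "c \<in> M C" "d \<in> M C"
    and "\<And>k. k < n \<Longrightarrow> up (Xs k) C (\<iota> k) c = up (Xs k) C (\<iota> k) d"
  shows "c = d"
proof -
  have "(\<lambda>k\<in>{..<n}. up (Xs k) C (\<iota> k) c) = (\<lambda>k\<in>{..<n}. up (Xs k) C (\<iota> k) d)"
    by (rule restrict_ext) (simp add: assms(4))
  from inj_onD[OF bij_betw_imp_inj_on[OF coproduct[OF assms(1)]] this] show ?thesis
    using assms(2,3) .
qed

lemma coproduct_glue:
  assumes "is_coproduct G n Xs C \<iota>" "\<And>k. k < n \<Longrightarrow> m k \<in> M (Xs k)"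
  shows "\<exists>c\<in>M C. \<forall>k<n. up (Xs k) C (\<iota> k) c = m k"
proof -
  have "(\<lambda>k\<in>{..<n}. m k) \<in> (\<lambda>c. \<lambda>k\<in>{..<n}. up (Xs k) C (\<iota> k) c) ` M C"
    unfolding bij_betw_imp_surj_on[OF coproduct[OF assms(1)]] by (simp add: restrict_PiE_iff assms(2))
  then obtain c where c: "c \<in> M C" "(\<lambda>k\<in>{..<n}. m k) = (\<lambda>k\<in>{..<n}. up (Xs k) C (\<iota> k) c)"
    by (rule imageE)
  have "up (Xs k) C (\<iota> k) c = m k" if "k < n" for k
    using that fun_cong[OF c(2), of k] by simp
  with c(1) show ?thesis by blast
qed

text \<open>The universal property gives mutually inverse comparison maps between two coproducts, so the
  description in \<^const>\<open>mackey_op\<close> determines its value.\<close>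

lemma mackey_op_unique:
  assumes C: "is_coproduct G 2 (\<lambda>_. X) C \<iota>" "\<delta> \<in> ghom G C X"
      "gcomp X \<delta> (\<iota> 0) = gid X" "gcomp X \<delta> (\<iota> 1) = gid X" "c \<in> M C"
    and D: "is_coproduct G 2 (\<lambda>_. X) D \<kappa>" "\<epsilon> \<in> ghom G D X"
      "gcomp X \<epsilon> (\<kappa> 0) = gid X" "gcomp X \<epsilon> (\<kappa> 1) = gid X" "d \<in> M D"
    and eq: "up X C (\<iota> 0) c = up X D (\<kappa> 0) d" "up X C (\<iota> 1) c = up X D (\<kappa> 1) d"
  shows "down C X \<delta> c = down D X \<epsilon> d"
proof -
  have lt2: "k = 0 \<or> k = 1" if "k < 2" for k :: nat using that by auto
  have finX: "fin_gset G X" using C(1) unfolding is_coproduct_def by force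
  have finC: "fin_gset G C" and \<iota>: "\<And>k. k < 2 \<Longrightarrow> \<iota> k \<in> ghom G X C"
    using C(1) unfolding is_coproduct_def by blast+
  have finD: "fin_gset G D" and \<kappa>: "\<And>k. k < 2 \<Longrightarrow> \<kappa> k \<in> ghom G X D"
    using D(1) unfolding is_coproduct_def by blast+
  note \<iota>_pts = ghom_closed[OF \<iota>] and \<kappa>_pts = ghom_closed[OF \<kappa>]
  have \<delta>\<iota>: "\<delta> (\<iota> k x) = x" and \<epsilon>\<kappa>: "\<epsilon> (\<kappa> k x) = x" if "k < 2" "x \<in> pts X" for k x
    using lt2[OF that(1)] gcomp_eqD[OF C(3) that(2)] gcomp_eqD[OF C(4) that(2)]
      gcomp_eqD[OF D(3) that(2)] gcomp_eqD[OF D(4) that(2)] gid_apply[OF that(2)] by metis+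
  obtain u where u: "u \<in> ghom G C D" "\<And>k x. k < 2 \<Longrightarrow> x \<in> pts X \<Longrightarrow> u (\<iota> k x) = \<kappa> k x"
    using coproduct_ghom[OF C(1) finD, of \<kappa>] \<kappa> by auto
  obtain v where v: "v \<in> ghom G D C" "\<And>k x. k < 2 \<Longrightarrow> x \<in> pts X \<Longrightarrow> v (\<kappa> k x) = \<iota> k x"
    using coproduct_ghom[OF D(1) finC, of \<iota>] \<iota> by auto
  \<comment> \<open>The composite fixes both injections, hence is the identity by joint epicness;
    the other composite and compatibility with the folding maps follow the same way.\<close>
  have "gcomp C v u = gid C"
    by (rule coproduct_ghom_eq[OF C(1) finC gcomp_ghom[OF finC u(1) v(1)] gid_ghom[OF finC]])
      (simp add: compose_eq gid_apply \<iota>_pts u v)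
  then have vu: "v (u z) = z" if "z \<in> pts C" for z
    using gcomp_eqD gid_apply that by metis
  have "gcomp D u v = gid D"
    by (rule coproduct_ghom_eq[OF D(1) finD gcomp_ghom[OF finD v(1) u(1)] gid_ghom[OF finD]])
      (simp add: compose_eq gid_apply \<kappa>_pts u v)
  then have uv: "u (v z) = z" if "z \<in> pts D" for z
    using gcomp_eqD gid_apply that by metis
  have "gcomp C \<epsilon> u = \<delta>"
    by (rule coproduct_ghom_eq[OF C(1) finX gcomp_ghom[OF finC u(1) D(2)] C(2)])
      (simp add: compose_eq \<iota>_pts u \<delta>\<iota> \<epsilon>\<kappa>)
  then have \<epsilon>u: "\<epsilon> (u z) = \<delta> z" if "z \<in> pts C" for z
    using gcomp_eqD that by metis
  \<comment> \<open>Since u carries each injection of \<open>C\<close> to that of \<open>D\<close>,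
    both elements have the same restrictions to the two copies. Pushing along the isomorphism u then
    recovers d from c, and the two folded values coincide.\<close>
  have "up C D u d = c"
  proof (rule coproduct_inj[OF C(1)])
    fix k :: nat assume k: "k < 2"
    have "up X C (\<iota> k) (up C D u d) = up X D (\<kappa> k) d"
      using finX finC finD \<iota>[OF k] u(1) \<kappa>[OF k] u(2)[OF k] D(5) by (rule up_up)
    then show "up X C (\<iota> k) (up C D u d) = up X C (\<iota> k) c"
      using eq lt2[OF k] by auto
  qed (fact C(5) up_in[OF finC finD u(1) D(5)])+
  then have "down C D u c = d"
    using down_up_iso[OF finC finD u(1) v(1) vu uv D(5)] by simp
  moreover have "down D X \<epsilon> (down C D u c) = down C X \<delta> c"
    using finC finD finX u(1) D(2) C(2) \<epsilon>u C(5) by (rule down_down)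
  ultimately show ?thesis by simp
qed

text \<open>Evaluates the definite description: by independence, one disjoint union suffices. The
  operands are written as restrictions of one element, since later arguments manipulate that element
  and its images rather than the operands.\<close>

lemma mackey_op_eq:
  assumes du: "disjoint_union G 2 (\<lambda>_. X) C \<iota>" and \<delta>: "\<delta> \<in> ghom G C X"
    and fold: "\<And>k x. k < 2 \<Longrightarrow> x \<in> pts X \<Longrightarrow> \<delta> (\<iota> k x) = x" and c: "c \<in> M C"
  shows "mackey_op G M up down X (up X C (\<iota> 0) c) (up X C (\<iota> 1) c) = down C X \<delta> c"
proof -
  have cop: "is_coproduct G 2 (\<lambda>_. X) C \<iota>" by (rule disjoint_union_is_coproduct[OF du])
  have X: "fin_gset G X" using disjoint_unionD(2)[OF du, of 0] by simp
  have "gcomp X \<delta> (\<iota> k) = gid X" if "k < 2" for k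
    using that \<delta> X disjoint_unionD[OF du] fold gid_ghom[OF X]
    by (intro gcomp_eqI[of G X "\<iota> k" C \<delta> X]) (auto simp: gid_apply)
  then have \<delta>\<iota>: "gcomp X \<delta> (\<iota> 0) = gid X" "gcomp X \<delta> (\<iota> 1) = gid X" by auto
  show ?thesis
    unfolding mackey_op_def
  proof (rule the_equality)
    show "\<exists>C' \<iota>' \<delta>' c'. is_coproduct G 2 (\<lambda>_. X) C' \<iota>' \<and> \<delta>' \<in> ghom G C' X \<and>
      gcomp X \<delta>' (\<iota>' 0) = gid X \<and> gcomp X \<delta>' (\<iota>' 1) = gid X \<and> c' \<in> M C' \<and>
      up X C' (\<iota>' 0) c' = up X C (\<iota> 0) c \<and> up X C' (\<iota>' 1) c' = up X C (\<iota> 1) c \<and>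
      down C X \<delta> c = down C' X \<delta>' c'"
      using cop \<delta> \<delta>\<iota> c by blast
  next
    fix s
    assume "\<exists>C' \<iota>' \<delta>' c'. is_coproduct G 2 (\<lambda>_. X) C' \<iota>' \<and> \<delta>' \<in> ghom G C' X \<and>
      gcomp X \<delta>' (\<iota>' 0) = gid X \<and> gcomp X \<delta>' (\<iota>' 1) = gid X \<and> c' \<in> M C' \<and>
      up X C' (\<iota>' 0) c' = up X C (\<iota> 0) c \<and> up X C' (\<iota>' 1) c' = up X C (\<iota> 1) c \<and>
      s = down C' X \<delta>' c'"
    then show "s = down C X \<delta> c"
      using mackey_op_unique[OF _ _ _ _ _ cop \<delta> \<delta>\<iota> c] by blast
  qed
qed

section \<open>Commutativity and associativity\<close>

lemma
  assumes "fin_gset G X" "a \<in> M X" "b \<in> M X"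
  shows mackey_op_closed: "mackey_op G M up down X a b \<in> M X"
    and mackey_op_commute: "mackey_op G M up down X a b = mackey_op G M up down X b a"
proof -
  obtain C \<iota> \<delta> where C: "disjoint_union G 2 (\<lambda>_. X) C \<iota>" "\<delta> \<in> ghom G C X"
    "\<And>k x. k < 2 \<Longrightarrow> x \<in> pts X \<Longrightarrow> \<delta> (\<iota> k x) = x"
    using ex_copies[OF group_axioms assms(1)] by blast
  have "(if k = 0 then a else b) \<in> M X" for k :: nat
    using assms by simp
  then obtain c where c: "c \<in> M C" "\<And>k. k < 2 \<Longrightarrow> up X C (\<iota> k) c = (if k = 0 then a else b)"
    using coproduct_glue[OF disjoint_union_is_coproduct[OF C(1)], of "\<lambda>k. if k = 0 then a else b"]
    by blast
  have ab: "mackey_op G M up down X a b = down C X \<delta> c"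
    using mackey_op_eq[OF C c(1)] c(2) by simp
  show "mackey_op G M up down X a b \<in> M X"
    unfolding ab using assms(1) disjoint_unionD(1)[OF C(1)] C(2) c(1) by (intro down_in)
  \<comment> \<open>On 0 and 1 this is the swap. It exchanges the two restrictions of c but leaves c
    and the folding map alone.\<close>
  have "bij_betw (\<lambda>k::nat. 1 - k) {..<2} {..<2}"
    by (rule bij_betw_byWitness[where f' = "\<lambda>k. 1 - k"]) auto
  from disjoint_union_permute[OF C(1) this] have "disjoint_union G 2 (\<lambda>_. X) C (\<lambda>k. \<iota> (1 - k))" .
  from mackey_op_eq[OF this C(2) _ c(1)] have "mackey_op G M up down X b a = down C X \<delta> c"
    using C(3) c(2) by simp
  with ab show "mackey_op G M up down X a b = mackey_op G M up down X b a" by simp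
qed

text \<open>Here s keeps copy 0 and folds copies 1 and 2 together. Base change along the first
  injection sees one copy with the identity; along the second it sees two copies with the folding
  map, which is the operation.\<close>

lemma push_codiagonal:
  assumes A: "disjoint_union G 3 (\<lambda>_. X) A \<kappa>" and B: "disjoint_union G 2 (\<lambda>_. X) B \<iota>"
    and s: "s \<in> ghom G A B" "\<And>k x. k < 3 \<Longrightarrow> x \<in> pts X \<Longrightarrow> s (\<kappa> k x) = \<iota> (if k = 0 then 0 else 1) x"
    and t: "t \<in> M A"
  shows "up X B (\<iota> 0) (down A B s t) = up X A (\<kappa> 0) t"
    and "up X B (\<iota> 1) (down A B s t) = mackey_op G M up down X (up X A (\<kappa> 1) t) (up X A (\<kappa> 2) t)"
proof -
  have X: "fin_gset G X" using disjoint_unionD(2)[OF B, of 0] by simp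
  note finA = disjoint_unionD(1)[OF A] and finB = disjoint_unionD(1)[OF B]
  note \<kappa> = disjoint_unionD(3,4)[OF A] and \<iota> = disjoint_unionD(3,4)[OF B]
  note \<kappa>_eq = disjoint_union_eq_iff[OF A] and \<iota>_eq = disjoint_union_eq_iff[OF B]
  have "up X B (\<iota> 0) (down A B s t) = down X X (gid X) (up X A (\<kappa> 0) t)"
  proof (rule up_down)
    show "\<exists>z\<in>pts X. \<kappa> 0 z = x \<and> gid X z = y"
      if x: "x \<in> pts A" and y: "y \<in> pts X" and "s x = \<iota> 0 y" for x y
    proof -
      obtain k z where "k < 3" "z \<in> pts X" "x = \<kappa> k z" by (rule disjoint_union_cases[OF A x])
      with that show ?thesis by (auto simp: s \<iota>_eq gid_apply split: if_splits)
    qed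
  qed (use X finA finB s t \<kappa> \<iota> gid_ghom in \<open>auto simp: gid_apply\<close>)
  then show "up X B (\<iota> 0) (down A B s t) = up X A (\<kappa> 0) t"
    using X finA \<kappa>(1) t by (simp add: down_id up_in)
  obtain \<delta> where \<delta>: "\<delta> \<in> ghom G B X" "\<And>k x. k < 2 \<Longrightarrow> x \<in> pts X \<Longrightarrow> \<delta> (\<iota> k x) = x"
    using disjoint_union_fold[OF B X] by auto
  \<comment> \<open>The inclusion of copies 1 and 2 into \<open>A\<close>, hence the shift by
    \<open>Suc\<close>; it is the corner of the second square.\<close>
  obtain l where l: "l \<in> ghom G B A" "\<And>k x. k < 2 \<Longrightarrow> x \<in> pts X \<Longrightarrow> l (\<iota> k x) = \<kappa> (Suc k) x"
    using disjoint_union_ghom[OF B, of "\<lambda>k. \<kappa> (Suc k)" A] \<kappa>(1) by auto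
  have "up X B (\<iota> 1) (down A B s t) = down B X \<delta> (up B A l t)"
  proof (rule up_down)
    show "s (l z) = \<iota> 1 (\<delta> z)" if z: "z \<in> pts B" for z
      by (rule disjoint_union_cases[OF B z]) (auto simp: s l \<delta>)
    show "\<exists>z\<in>pts B. l z = x \<and> \<delta> z = y"
      if x: "x \<in> pts A" and y: "y \<in> pts X" and "s x = \<iota> 1 y" for x y
    proof -
      obtain k z where k: "k < 3" "z \<in> pts X" "x = \<kappa> k z" by (rule disjoint_union_cases[OF A x])
      then have "k \<noteq> 0 \<and> z = y"
        using that by (cases "k = 0") (auto simp: s \<iota>_eq)
      then have "\<iota> (k - 1) y \<in> pts B" "l (\<iota> (k - 1) y) = x" "\<delta> (\<iota> (k - 1) y) = y"
        using k y \<iota>(2) by (auto simp: l \<delta>)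
      then show ?thesis by blast
    qed
    show "z = w" if z: "z \<in> pts B" and w: "w \<in> pts B" and "l z = l w" for z w
    proof -
      obtain j x where "j < 2" "x \<in> pts X" "z = \<iota> j x" by (rule disjoint_union_cases[OF B z])
      moreover obtain k y where "k < 2" "y \<in> pts X" "w = \<iota> k y" by (rule disjoint_union_cases[OF B w])
      ultimately show ?thesis using that by (auto simp: l \<kappa>_eq)
    qed
  qed (use X finA finB s t \<iota> \<delta> l in auto)
  also have "\<dots> = mackey_op G M up down X (up X B (\<iota> 0) (up B A l t)) (up X B (\<iota> 1) (up B A l t))"
    using mackey_op_eq[OF B \<delta>(1) _ up_in[OF finB finA l(1) t]] \<delta>(2) by simp
  also have "up X B (\<iota> 0) (up B A l t) = up X A (\<kappa> 1) t"
    using X finA finB \<iota>(1) \<kappa>(1) l t by (intro up_up) auto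
  also have "up X B (\<iota> 1) (up B A l t) = up X A (\<kappa> 2) t"
    using X finA finB \<iota>(1) \<kappa>(1) l t by (intro up_up) (auto simp: numeral_2_eq_2)
  finally show "up X B (\<iota> 1) (down A B s t) =
    mackey_op G M up down X (up X A (\<kappa> 1) t) (up X A (\<kappa> 2) t)" .
qed

text \<open>Folding three copies factors as s followed by folding two. The nested expression thus
  becomes a single push along the threefold folding map, whose form no longer depends on the order
  of the copies.\<close>

lemma mackey_op_triple:
  assumes A: "disjoint_union G 3 (\<lambda>_. X) A \<kappa>" and \<epsilon>: "\<epsilon> \<in> ghom G A X"
    and fold: "\<And>k x. k < 3 \<Longrightarrow> x \<in> pts X \<Longrightarrow> \<epsilon> (\<kappa> k x) = x" and t: "t \<in> M A"
  shows "mackey_op G M up down X (up X A (\<kappa> 0) t)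
      (mackey_op G M up down X (up X A (\<kappa> 1) t) (up X A (\<kappa> 2) t)) = down A X \<epsilon> t"
proof -
  have X: "fin_gset G X" using disjoint_unionD(2)[OF A, of 0] by simp
  obtain B \<iota> \<delta> where B: "disjoint_union G 2 (\<lambda>_. X) B \<iota>" "\<delta> \<in> ghom G B X"
    "\<And>k x. k < 2 \<Longrightarrow> x \<in> pts X \<Longrightarrow> \<delta> (\<iota> k x) = x"
    using ex_copies[OF group_axioms X] by blast
  note fin = disjoint_unionD(1)[OF A] disjoint_unionD(1)[OF B(1)]
  obtain s where s: "s \<in> ghom G A B"
    "\<And>k x. k < 3 \<Longrightarrow> x \<in> pts X \<Longrightarrow> s (\<kappa> k x) = \<iota> (if k = 0 then 0 else 1) x"
    using disjoint_union_ghom[OF A, of "\<lambda>k. \<iota> (if k = 0 then 0 else 1)" B] disjoint_unionD(3)[OF B(1)]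
    by auto
  have "down B X \<delta> (down A B s t) = down A X \<epsilon> t"
  proof (rule down_down)
    show "\<delta> (s z) = \<epsilon> z" if z: "z \<in> pts A" for z
      by (rule disjoint_union_cases[OF A z]) (simp add: s B(3) fold)
  qed (use X fin s B(2) \<epsilon> t in auto)
  then show ?thesis
    using mackey_op_eq[OF B down_in[OF fin s(1) t]] push_codiagonal[OF A B(1) s t] by simp
qed

lemma mackey_op_assoc:
  assumes "fin_gset G X" "a \<in> M X" "b \<in> M X" "c \<in> M X"
  shows "mackey_op G M up down X (mackey_op G M up down X a b) c =
    mackey_op G M up down X a (mackey_op G M up down X b c)"
proof -
  obtain A \<kappa> \<epsilon> where A: "disjoint_union G 3 (\<lambda>_. X) A \<kappa>" "\<epsilon> \<in> ghom G A X"
    "\<And>k x. k < 3 \<Longrightarrow> x \<in> pts X \<Longrightarrow> \<epsilon> (\<kappa> k x) = x"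
    using ex_copies[OF group_axioms assms(1)] by blast
  have "[a, b, c] ! k \<in> M X" if "k < 3" for k
    using that assms by (auto simp: nth_Cons')
  then obtain t where t: "t \<in> M A" "\<And>k. k < 3 \<Longrightarrow> up X A (\<kappa> k) t = [a, b, c] ! k"
    using coproduct_glue[OF disjoint_union_is_coproduct[OF A(1)], of "\<lambda>k. [a, b, c] ! k"] by auto
  \<comment> \<open>A cyclic relabelling reads the same push as c with (a with b); commutativity
    then moves c to the right.\<close>
  have "bij_betw (\<lambda>k::nat. if k = 0 then 2 else k - 1) {..<3} {..<3}"
    by (rule bij_betw_byWitness[where f' = "\<lambda>k. if k = 2 then 0 else k + 1"]) auto
  from disjoint_union_permute[OF A(1) this]
  have "disjoint_union G 3 (\<lambda>_. X) A (\<lambda>k. \<kappa> (if k = 0 then 2 else k - 1))" .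
  from mackey_op_triple[OF this A(2) _ t(1)]
  have "mackey_op G M up down X c (mackey_op G M up down X a b) = down A X \<epsilon> t"
    using A(3) t(2) by simp
  moreover have "mackey_op G M up down X a (mackey_op G M up down X b c) = down A X \<epsilon> t"
    using mackey_op_triple[OF A t(1)] t(2) by simp
  ultimately show ?thesis
    using assms mackey_op_commute[of X c] mackey_op_closed by simp
qed

text \<open>Push a into the second copy of X. The two copies are disjoint, so restricting to the
  first copy passes through the empty G-set, while restricting to the second returns a. Folding
  undoes the inclusion and also gives a.\<close>

lemma mackey_op_initial:
  assumes X: "fin_gset G X" and E: "disjoint_union G 0 Xs E \<kappa>" and e: "e \<in> M E"
    and z: "z \<in> ghom G E X" and a: "a \<in> M X"
  shows "mackey_op G M up down X (down E X z e) a = a"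
proof -
  obtain C \<iota> \<delta> where C: "disjoint_union G 2 (\<lambda>_. X) C \<iota>" "\<delta> \<in> ghom G C X"
    "\<And>k x. k < 2 \<Longrightarrow> x \<in> pts X \<Longrightarrow> \<delta> (\<iota> k x) = x"
    using ex_copies[OF group_axioms X] by blast
  note finC = disjoint_unionD(1)[OF C(1)] and \<iota> = disjoint_unionD(3,4)[OF C(1)]
  have finE: "fin_gset G E" by (rule disjoint_unionD(1)[OF E])
  have ptsE: "pts E = {}" by (auto elim: disjoint_union_cases[OF E])
  define c where "c = down X C (\<iota> 1) a"
  have c: "c \<in> M C" unfolding c_def using X finC \<iota> a by (intro down_in) auto
  have "up X C (\<iota> 1) c = down X X (gid X) (up X X (gid X) a)"
    unfolding c_def
    by (rule up_down)
      (use X finC \<iota> a gid_ghom[OF X] in \<open>auto simp: gid_apply disjoint_union_eq_iff[OF C(1)]\<close>)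
  then have c1: "up X C (\<iota> 1) c = a" using X a by (simp add: up_id down_id)
  have "up X C (\<iota> 0) c = down E X z (up E X z a)"
    unfolding c_def
    by (rule up_down)
      (use X finC finE \<iota> a z in \<open>auto simp: ptsE disjoint_union_eq_iff[OF C(1)]\<close>)
  \<comment> \<open>Both lie in the value at the empty coproduct, where injectivity has no
    restrictions to compare.\<close>
  moreover have "up E X z a = e"
    by (rule coproduct_inj[OF disjoint_union_is_coproduct[OF E]])
      (use X finE z a e up_in in auto)
  ultimately have c0: "up X C (\<iota> 0) c = down E X z e" by simp
  have "down C X \<delta> c = down X X (gid X) a"
    unfolding c_def using X finC \<iota>(1) C gid_ghom[OF X] a
    by (intro down_down) (auto simp: gid_apply)
  then show ?thesis
    using mackey_op_eq[OF C c] c0 c1 X a by (simp add: down_id)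
qed

lemma mackey_unit_eq:
  assumes X: "fin_gset G X" and E: "disjoint_union G 0 Xs E \<kappa>" and e: "e \<in> M E"
    and z: "z \<in> ghom G E X"
  shows "mackey_unit G M up down X = down E X z e"
  unfolding mackey_unit_def
proof (rule the_equality)
  have in_M: "down E X z e \<in> M X"
    using X disjoint_unionD(1)[OF E] e z by (intro down_in)
  note unit = mackey_op_initial[OF X E e z]
  show "down E X z e \<in> M X \<and> (\<forall>a\<in>M X. mackey_op G M up down X (down E X z e) a = a \<and>
    mackey_op G M up down X a (down E X z e) = a)"
    using in_M unit mackey_op_commute[OF X in_M] by simp
  fix d assume "d \<in> M X \<and> (\<forall>a\<in>M X. mackey_op G M up down X d a = a \<and>
    mackey_op G M up down X a d = a)"
  then have "d \<in> M X" "mackey_op G M up down X (down E X z e) d = down E X z e"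
    using in_M by blast+
  with unit[of d] show "d = down E X z e" by simp
qed

lemma ex_initial:
  obtains E \<kappa> e where "disjoint_union G 0 (\<lambda>_. E) E \<kappa>" "e \<in> M E" "pts E = {}"
    "\<And>X :: ('g, 'u) gset. \<exists>z. z \<in> ghom G E X"
proof -
  obtain E \<kappa> where E: "disjoint_union G 0 (\<lambda>_. undefined :: ('g, 'u) gset) E \<kappa>"
    using ex_disjoint_union[OF group_axioms, of 0 "\<lambda>_. undefined"] by blast
  have E': "disjoint_union G 0 (\<lambda>_. E) E \<kappa>"
    using E by (simp add: disjoint_union_def)
  \<comment> \<open>Gluing the empty family shows that the value at the empty G-set is
    inhabited.\<close>
  obtain e where "e \<in> M E"
    using coproduct_glue[OF disjoint_union_is_coproduct[OF E], of undefined] by auto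
  moreover have "pts E = {}" by (auto elim: disjoint_union_cases[OF E])
  moreover have "\<exists>z. z \<in> ghom G E X" for X :: "('g, 'u) gset"
    using disjoint_union_ghom[OF E, of undefined X] by auto
  ultimately show ?thesis using that E' by blast
qed

lemma mackey_unit:
  assumes "fin_gset G X"
  shows "mackey_unit G M up down X \<in> M X"
    and "a \<in> M X \<Longrightarrow> mackey_op G M up down X (mackey_unit G M up down X) a = a"
proof -
  obtain E \<kappa> e where E: "disjoint_union G 0 (\<lambda>_. E) E \<kappa>" "e \<in> M E"
    "\<And>X :: ('g, 'u) gset. \<exists>z. z \<in> ghom G E X"
    by (rule ex_initial) blast
  obtain z where z: "z \<in> ghom G E X" using E(3) by blast
  show "mackey_unit G M up down X \<in> M X"
    using mackey_unit_eq[OF assms E(1,2) z] down_in disjoint_unionD(1)[OF E(1)] assms E z by simp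
  show "a \<in> M X \<Longrightarrow> mackey_op G M up down X (mackey_unit G M up down X) a = a"
    using mackey_unit_eq[OF assms E(1,2) z] mackey_op_initial[OF assms E(1,2) z] by simp
qed

text \<open>The pull-back of the empty G-set along f is empty, so base change turns the push from
  the empty set into Y into the one into X.\<close>

lemma up_mackey_unit:
  assumes X: "fin_gset G X" and Y: "fin_gset G Y" and f: "f \<in> ghom G X Y"
  shows "up X Y f (mackey_unit G M up down Y) = mackey_unit G M up down X"
proof -
  obtain E \<kappa> e where E: "disjoint_union G 0 (\<lambda>_. E) E \<kappa>" "e \<in> M E" "pts E = {}"
    "\<And>X :: ('g, 'u) gset. \<exists>z. z \<in> ghom G E X"
    by (rule ex_initial) blast
  obtain z w where z: "z \<in> ghom G E X" "w \<in> ghom G E Y" using E(4) by blast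
  have finE: "fin_gset G E" by (rule disjoint_unionD(1)[OF E(1)])
  have "up X Y f (down E Y w e) = down E X z (up E E (gid E) e)"
    by (rule up_down) (use X Y f finE E z gid_ghom[OF finE] in auto)
  then show ?thesis
    using mackey_unit_eq[OF Y E(1,2) z(2)] mackey_unit_eq[OF X E(1,2) z(1)] up_id[OF finE E(2)]
    by simp
qed

text \<open>Functoriality alone: a map out of the empty set followed by f is again the map out of
  the empty set.\<close>

lemma down_mackey_unit:
  assumes X: "fin_gset G X" and Y: "fin_gset G Y" and f: "f \<in> ghom G X Y"
  shows "down X Y f (mackey_unit G M up down X) = mackey_unit G M up down Y"
proof -
  obtain E \<kappa> e where E: "disjoint_union G 0 (\<lambda>_. E) E \<kappa>" "e \<in> M E" "pts E = {}"
    "\<And>X :: ('g, 'u) gset. \<exists>z. z \<in> ghom G E X"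
    by (rule ex_initial) blast
  obtain z w where z: "z \<in> ghom G E X" "w \<in> ghom G E Y" using E(4) by blast
  have finE: "fin_gset G E" by (rule disjoint_unionD(1)[OF E(1)])
  have "down X Y f (down E X z e) = down E Y w e"
    by (rule down_down[OF finE X Y z(1) f z(2) _ E(2)]) (simp add: E(3))
  then show ?thesis
    using mackey_unit_eq[OF Y E(1,2) z(2)] mackey_unit_eq[OF X E(1,2) z(1)] by simp
qed

end


subsection \<open>Distributivity\<close>

text \<open>Over a point \<open>x\<close>, the fibre of \<open>B = X \<amalg> X\<close> is two points, and there are exactly two sections
  of \<open>id \<amalg> \<nabla> : X \<amalg> X \<amalg> X \<rightarrow> X \<amalg> X\<close> over it, namely the restrictions of \<open>l 0\<close> and \<open>l 1\<close>.\<close>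

lemma is_exponential_codiagonal:
  fixes X A B Z :: "('g, 'u) gset"
  assumes G: "group G" and X: "fin_gset G X"
    and A: "disjoint_union G 3 (\<lambda>_. X) A \<kappa>" and B: "disjoint_union G 2 (\<lambda>_. X) B \<iota>"
    and Z: "disjoint_union G 2 (\<lambda>_. B) Z \<zeta>"
    and p: "p \<in> ghom G A B" "\<And>k x. k < 3 \<Longrightarrow> x \<in> pts X \<Longrightarrow> p (\<kappa> k x) = \<iota> (if k = 0 then 0 else 1) x"
    and \<delta>: "\<delta> \<in> ghom G B X" "\<And>k x. k < 2 \<Longrightarrow> x \<in> pts X \<Longrightarrow> \<delta> (\<iota> k x) = x"
    and l: "\<And>i. i < 2 \<Longrightarrow> l i \<in> ghom G B A"
      "\<And>i j x. i < 2 \<Longrightarrow> j < 2 \<Longrightarrow> x \<in> pts X \<Longrightarrow> l i (\<iota> j x) = \<kappa> (if j = 0 then 0 else Suc i) x"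
    and r: "r \<in> ghom G Z B" "\<And>i w. i < 2 \<Longrightarrow> w \<in> pts B \<Longrightarrow> r (\<zeta> i w) = \<iota> i (\<delta> w)"
    and L: "L \<in> ghom G Z A" "\<And>i w. i < 2 \<Longrightarrow> w \<in> pts B \<Longrightarrow> L (\<zeta> i w) = l i w"
  shows "is_exponential G B A X Z B p \<delta> L r \<delta>"
proof -
  interpret group G by (rule G)
  note finA = disjoint_unionD(1)[OF A] and finB = disjoint_unionD(1)[OF B]
    and finZ = disjoint_unionD(1)[OF Z]
  note \<kappa> = disjoint_unionD(3,4)[OF A] and \<iota> = disjoint_unionD(3,4)[OF B]
    and \<zeta> = disjoint_unionD(3,4)[OF Z]
  note \<kappa>_eq = disjoint_union_eq_iff[OF A] and \<iota>_eq = disjoint_union_eq_iff[OF B]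
    and \<zeta>_eq = disjoint_union_eq_iff[OF Z]
  define F where "F = exp_fibre B \<delta>"
  define P where "P = exp_Pi G B A X p \<delta>"
  define Q where "Q = exp_Z G B A X p \<delta>"
  define sec where "sec i x = restrict (l i) (F x)" for i x
  have F_iff: "w \<in> F x \<longleftrightarrow> w \<in> pts B \<and> \<delta> w = x" for w x
    by (auto simp: F_def exp_fibre_def)
  have F_eq: "F x = {\<iota> 0 x, \<iota> 1 x}" if x: "x \<in> pts X" for x
  proof (intro equalityI subsetI)
    fix w assume w: "w \<in> F x"
    then obtain k y where k: "k < 2" "y \<in> pts X" "w = \<iota> k y"
      using disjoint_union_cases[OF B, of w] by (auto simp: F_iff)
    moreover have "y = x" using w k \<delta> by (simp add: F_iff)
    moreover have "k = 0 \<or> k = 1" using k(1) by auto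
    ultimately show "w \<in> {\<iota> 0 x, \<iota> 1 x}" by auto
  qed (use x \<iota> \<delta> in \<open>auto simp: F_iff\<close>)
  have pl: "p (l i w) = w" if i: "i < 2" and w: "w \<in> pts B" for i w
  proof -
    obtain k x where "k < 2" "x \<in> pts X" "w = \<iota> k x" by (rule disjoint_union_cases[OF B w])
    moreover from this have "k = 0 \<or> k = 1" by auto
    ultimately show ?thesis using i by (auto simp: l p)
  qed
  have P_iff: "(x, \<sigma>) \<in> pts P \<longleftrightarrow> x \<in> pts X \<and> \<sigma> \<in> F x \<rightarrow>\<^sub>E pts A \<and> (\<forall>w\<in>F x. p (\<sigma> w) = w)" for x \<sigma>
    by (simp add: P_def exp_Pi_def F_def Let_def)
  have P_act: "act P g (x, \<sigma>) = (act X g x, \<lambda>w\<in>F (act X g x). act A g (\<sigma> (act B (inv\<^bsub>G\<^esub> g) w)))"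
    if "(x, \<sigma>) \<in> pts P" for g x \<sigma>
    using that by (simp add: P_def exp_Pi_def F_def Let_def)
  have Q_iff: "(w, q) \<in> pts Q \<longleftrightarrow> w \<in> pts B \<and> q \<in> pts P \<and> \<delta> w = fst q" for w q
    by (simp add: Q_def exp_Z_def P_def Let_def)
  have Q_act: "act Q g (w, q) = (act B g w, act P g q)" if "(w, q) \<in> pts Q" for g w q
    using that by (simp add: Q_def exp_Z_def P_def Let_def)
  have sec_P: "(x, sec i x) \<in> pts P" if "i < 2" "x \<in> pts X" for i x
    using that pl ghom_closed[OF l(1)] by (auto simp: P_iff sec_def F_iff)
  \<comment> \<open>Conjugating a restriction of \<open>l i\<close> gives the restriction of
    \<open>l i\<close> over the moved point, because \<open>l i\<close> is equivariant.\<close>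
  have sec_act: "act P g (x, sec i x) = (act X g x, sec i (act X g x))"
    if i: "i < 2" and x: "x \<in> pts X" and g: "g \<in> carrier G" for i x g
  proof -
    have "act A g (sec i x (act B (inv\<^bsub>G\<^esub> g) w)) = l i w" if "w \<in> F (act X g x)" for w
    proof -
      have w: "w \<in> pts B" "\<delta> w = act X g x" using that by (auto simp: F_iff)
      have w': "act B (inv\<^bsub>G\<^esub> g) w \<in> pts B" using finB g w by (simp add: act_closed)
      have "\<delta> (act B (inv\<^bsub>G\<^esub> g) w) = x"
        using ghom_act[OF \<delta>(1) inv_closed[OF g] w(1)] w(2) act_inv(1)[OF X g x] by simp
      then have "sec i x (act B (inv\<^bsub>G\<^esub> g) w) = l i (act B (inv\<^bsub>G\<^esub> g) w)"
        using w' by (simp add: sec_def F_iff)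
      then show ?thesis
        using ghom_act[OF l(1)[OF i] g w'] act_inv(2)[OF finB g w(1)] by simp
    qed
    then show ?thesis
      unfolding P_act[OF sec_P[OF i x]] by (auto simp: sec_def[of i "act X g x"])
  qed
  \<comment> \<open>Over the first point of the fibre only copy 0 of \<open>A\<close> is available,
    so the section is forced there; over the second point copies 1 and 2 are, and this choice is the
    index i.\<close>
  have sec_cases: "\<exists>i<2. \<sigma> = sec i x" if P: "(x, \<sigma>) \<in> pts P" for x \<sigma>
  proof -
    have x: "x \<in> pts X" and \<sigma>: "\<sigma> \<in> F x \<rightarrow>\<^sub>E pts A" and p\<sigma>: "\<And>w. w \<in> F x \<Longrightarrow> p (\<sigma> w) = w"
      using P P_iff by auto
    have F: "\<iota> 0 x \<in> F x" "\<iota> 1 x \<in> F x" using F_eq[OF x] by auto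
    obtain k y where k: "k < 3" "y \<in> pts X" "\<sigma> (\<iota> 0 x) = \<kappa> k y"
      using disjoint_union_cases[OF A, of "\<sigma> (\<iota> 0 x)"] \<sigma> F(1) by blast
    have "\<iota> (if k = 0 then 0 else 1) y = \<iota> 0 x" using p\<sigma>[OF F(1)] k p(2) by simp
    then have "k = 0 \<and> y = x" using k x \<iota>_eq[of "if k = 0 then 0 else 1" 0 y x] by (cases "k = 0") auto
    with k have \<sigma>0: "\<sigma> (\<iota> 0 x) = \<kappa> 0 x" by simp
    obtain k y where k: "k < 3" "y \<in> pts X" "\<sigma> (\<iota> 1 x) = \<kappa> k y"
      using disjoint_union_cases[OF A, of "\<sigma> (\<iota> 1 x)"] \<sigma> F(2) by blast
    have "\<iota> (if k = 0 then 0 else 1) y = \<iota> 1 x" using p\<sigma>[OF F(2)] k p(2) by simp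
    then have "k \<noteq> 0 \<and> y = x" using k x \<iota>_eq[of "if k = 0 then 0 else 1" 1 y x] by (cases "k = 0") auto
    with k obtain i where i: "i < 2" "\<sigma> (\<iota> 1 x) = \<kappa> (Suc i) x" by (cases k) auto
    have "\<sigma> w = sec i x w" if "w \<in> F x" for w
      using that i(1) x \<sigma>0 i(2) l(2)[of i] F_eq[OF x] by (auto simp: sec_def)
    moreover have "\<sigma> \<in> extensional (F x)" "sec i x \<in> extensional (F x)"
      using \<sigma> by (auto simp: sec_def PiE_def)
    ultimately have "\<sigma> = sec i x" by (intro extensionalityI[of _ "F x"])
    with i(1) show ?thesis by blast
  qed
  \<comment> \<open>The two sections differ at the second point of the fibre, where they land in
    different copies of \<open>A\<close>.\<close>
  have sec_inj: "i = j" if "i < 2" "j < 2" "x \<in> pts X" "sec i x = sec j x" for i j x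
  proof -
    have "\<iota> 1 x \<in> F x" using F_eq that by simp
    then have "l i (\<iota> 1 x) = l j (\<iota> 1 x)" using fun_cong[OF that(4), of "\<iota> 1 x"] by (simp add: sec_def)
    then show ?thesis using that l(2)[of i 1 x] l(2)[of j 1 x] by (simp add: \<kappa>_eq)
  qed
  \<comment> \<open>One copy of X for each of the two sections, so \<open>B\<close> serves twice: as
    the source of the folding map and as a model of \<open>exp_Pi\<close>.\<close>
  have "(\<lambda>x\<in>pts X. (x, sec i x)) \<in> ghom G X P" if "i < 2" for i
    using that X by (auto simp: ghom_def sec_P sec_act act_closed)
  then obtain \<alpha> where \<alpha>: "\<alpha> \<in> ghom G B P" "\<And>i x. i < 2 \<Longrightarrow> x \<in> pts X \<Longrightarrow> \<alpha> (\<iota> i x) = (x, sec i x)"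
    using disjoint_union_ghom[OF B, of "\<lambda>i. \<lambda>x\<in>pts X. (x, sec i x)" P] by auto
  have secQ: "(w, \<delta> w, sec i (\<delta> w)) \<in> pts Q" if "i < 2" "w \<in> pts B" for i w
    using that sec_P ghom_closed[OF \<delta>(1)] by (simp add: Q_iff)
  \<comment> \<open>Likewise the fibre product is one copy of \<open>B\<close> per section, which is
    why \<open>Z\<close> is two copies of \<open>B\<close>.\<close>
  have "(\<lambda>w\<in>pts B. (w, \<delta> w, sec i (\<delta> w))) \<in> ghom G B Q" if "i < 2" for i
    using that finB ghom_closed[OF \<delta>(1)] ghom_act[OF \<delta>(1)]
    by (auto simp: ghom_def[of G B Q] secQ Q_act sec_act act_closed)
  then obtain \<beta> where \<beta>: "\<beta> \<in> ghom G Z Q"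
      "\<And>i w. i < 2 \<Longrightarrow> w \<in> pts B \<Longrightarrow> \<beta> (\<zeta> i w) = (w, \<delta> w, sec i (\<delta> w))"
    using disjoint_union_ghom[OF Z, of "\<lambda>i. \<lambda>w\<in>pts B. (w, \<delta> w, sec i (\<delta> w))" Q] by auto
  have "bij_betw \<alpha> (pts B) (pts P)"
    unfolding bij_betw_def
  proof
    show "inj_on \<alpha> (pts B)"
    proof (rule inj_onI)
      fix v w assume v: "v \<in> pts B" and w: "w \<in> pts B" and eq: "\<alpha> v = \<alpha> w"
      obtain i x where i: "i < 2" "x \<in> pts X" "v = \<iota> i x" by (rule disjoint_union_cases[OF B v])
      obtain j y where j: "j < 2" "y \<in> pts X" "w = \<iota> j y" by (rule disjoint_union_cases[OF B w])
      have "x = y" "sec i x = sec j x" using eq i j \<alpha>(2) by auto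
      then show "v = w" using i j sec_inj[of i j x] by simp
    qed
    have "q \<in> \<alpha> ` pts B" if "q \<in> pts P" for q
    proof -
      obtain x \<sigma> where q: "q = (x, \<sigma>)" by (cases q)
      then obtain i where i: "i < 2" "\<sigma> = sec i x" using \<open>q \<in> pts P\<close> sec_cases by blast
      moreover have x: "x \<in> pts X" using \<open>q \<in> pts P\<close> q P_iff by simp
      ultimately have "q = \<alpha> (\<iota> i x)" using q \<alpha>(2) by simp
      then show ?thesis using \<iota>(2)[OF i(1) x] by (rule image_eqI)
    qed
    then show "\<alpha> ` pts B = pts P" using ghom_closed[OF \<alpha>(1)] by blast
  qed
  then have \<alpha>_iso: "\<alpha> \<in> giso G B P" using \<alpha>(1) by (simp add: giso_def)
  have "bij_betw \<beta> (pts Z) (pts Q)"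
    unfolding bij_betw_def
  proof
    show "inj_on \<beta> (pts Z)"
    proof (rule inj_onI)
      fix z z' assume z: "z \<in> pts Z" and z': "z' \<in> pts Z" and eq: "\<beta> z = \<beta> z'"
      obtain i v where i: "i < 2" "v \<in> pts B" "z = \<zeta> i v" by (rule disjoint_union_cases[OF Z z])
      obtain j w where j: "j < 2" "w \<in> pts B" "z' = \<zeta> j w" by (rule disjoint_union_cases[OF Z z'])
      have "v = w" "sec i (\<delta> v) = sec j (\<delta> v)" using eq i j \<beta>(2) by auto
      then show "z = z'" using i j sec_inj[of i j "\<delta> v"] ghom_closed[OF \<delta>(1)] by simp
    qed
    have "q \<in> \<beta> ` pts Z" if q: "q \<in> pts Q" for q
    proof -
      obtain w x \<sigma> where w: "q = (w, x, \<sigma>)" by (cases q)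
      then have w': "w \<in> pts B" "(x, \<sigma>) \<in> pts P" "\<delta> w = x" using q by (auto simp: Q_iff)
      then obtain i where i: "i < 2" "\<sigma> = sec i x" using sec_cases by blast
      then have "q = \<beta> (\<zeta> i w)" using w w' \<beta>(2) by simp
      then show ?thesis using \<zeta>(2)[OF i(1) w'(1)] by (rule image_eqI)
    qed
    then show "\<beta> ` pts Z = pts Q" using ghom_closed[OF \<beta>(1)] by blast
  qed
  then have \<beta>_iso: "\<beta> \<in> giso G Z Q" using \<beta>(1) by (simp add: giso_def)
  have "\<forall>w\<in>pts B. \<delta> w = fst (\<alpha> w)"
    by (auto elim!: disjoint_union_cases[OF B] simp: \<alpha>(2) \<delta>(2))
  moreover have "\<forall>z\<in>pts Z. \<alpha> (r z) = snd (\<beta> z)"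
    using ghom_closed[OF \<delta>(1)] by (auto elim!: disjoint_union_cases[OF Z] simp: \<alpha>(2) \<beta>(2) r(2))
  moreover have "\<forall>z\<in>pts Z. L z = snd (snd (\<beta> z)) (fst (\<beta> z))"
    by (auto elim!: disjoint_union_cases[OF Z] simp: \<beta>(2) L(2) sec_def F_iff)
  ultimately show ?thesis
    unfolding is_exponential_def
    using finA finB finZ X p(1) \<delta>(1) L(1) r(1) \<alpha>_iso \<beta>_iso unfolding P_def Q_def by blast
qed

context tambara_functor
begin

text \<open>The exponential formula is applied to the element t of the triple sum with components a,
  b, c. Its left side adds b and c and then multiplies by a; its right side forms a product for each
  choice of b or c and then adds.\<close>

lemma tambara_distrib:
  assumes X: "fin_gset G X" and a: "a \<in> val T X" and b: "b \<in> val T X" and c: "c \<in> val T X"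
  defines "addT \<equiv> mackey_op G (val T) (res T) (tr T) X"
    and "mulT \<equiv> mackey_op G (val T) (res T) (nrm T) X"
  shows "mulT a (addT b c) = addT (mulT a b) (mulT a c)"
proof -
  note G = add.group_axioms
  obtain A \<kappa> where A: "disjoint_union G 3 (\<lambda>_. X) A \<kappa>"
    by (rule ex_disjoint_union[OF G X])
  obtain B \<iota> \<delta> where B: "disjoint_union G 2 (\<lambda>_. X) B \<iota>" and \<delta>: "\<delta> \<in> ghom G B X"
    "\<And>k x. k < 2 \<Longrightarrow> x \<in> pts X \<Longrightarrow> \<delta> (\<iota> k x) = x"
    using ex_copies[OF G X] by blast
  note finA = disjoint_unionD(1)[OF A] and finB = disjoint_unionD(1)[OF B]
  obtain Z \<zeta> where Z: "disjoint_union G 2 (\<lambda>_. B) Z \<zeta>"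
    by (rule ex_disjoint_union[OF G finB])
  note finZ = disjoint_unionD(1)[OF Z]
  note \<kappa> = disjoint_unionD(3,4)[OF A] and \<iota> = disjoint_unionD(3,4)[OF B]
    and \<zeta> = disjoint_unionD(3,4)[OF Z]
  have "[a, b, c] ! k \<in> val T X" if "k < 3" for k
    using that a b c by (auto simp: nth_Cons')
  then obtain t where t: "t \<in> val T A" "\<And>k. k < 3 \<Longrightarrow> res T X A (\<kappa> k) t = [a, b, c] ! k"
    using add.coproduct_glue[OF disjoint_union_is_coproduct[OF A], of "\<lambda>k. [a, b, c] ! k"] by auto
  have t_eq: "res T X A (\<kappa> 0) t = a" "res T X A (\<kappa> 1) t = b" "res T X A (\<kappa> 2) t = c"
    using t(2)[of 0] t(2)[of 1] t(2)[of 2] by simp_all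
  obtain p where p: "p \<in> ghom G A B"
    "\<And>k x. k < 3 \<Longrightarrow> x \<in> pts X \<Longrightarrow> p (\<kappa> k x) = \<iota> (if k = 0 then 0 else 1) x"
    using disjoint_union_ghom[OF A, of "\<lambda>k. \<iota> (if k = 0 then 0 else 1)" B] \<iota>(1) by auto
  \<comment> \<open>Choice 0 selects copies 0 and 1, carrying a and b; choice 1 selects copies 0 and
    2, carrying a and c.\<close>
  have "\<exists>u\<in>ghom G B A. \<forall>j<2. \<forall>x\<in>pts X. u (\<iota> j x) = \<kappa> (if j = 0 then 0 else Suc i) x" if "i < 2" for i
    using disjoint_union_ghom[OF B, of "\<lambda>j. \<kappa> (if j = 0 then 0 else Suc i)" A] \<kappa>(1) that by auto
  then obtain l where l: "\<And>i. i < 2 \<Longrightarrow> l i \<in> ghom G B A"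
      "\<And>i j x. i < 2 \<Longrightarrow> j < 2 \<Longrightarrow> x \<in> pts X \<Longrightarrow> l i (\<iota> j x) = \<kappa> (if j = 0 then 0 else Suc i) x"
    by metis
  obtain r where r: "r \<in> ghom G Z B" "\<And>i w. i < 2 \<Longrightarrow> w \<in> pts B \<Longrightarrow> r (\<zeta> i w) = \<iota> i (\<delta> w)"
    using disjoint_union_ghom[OF Z, of "\<lambda>i. gcomp B (\<iota> i) \<delta>" B] gcomp_ghom[OF finB \<delta>(1) \<iota>(1)]
    by (auto simp: compose_eq)
  obtain L where L: "L \<in> ghom G Z A" "\<And>i w. i < 2 \<Longrightarrow> w \<in> pts B \<Longrightarrow> L (\<zeta> i w) = l i w"
    using disjoint_union_ghom[OF Z, of l A] l(1) by auto
  have "nrm T B X \<delta> (tr T A B p t) = tr T B X \<delta> (nrm T Z B r (res T Z A L t))"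
    by (rule exponential[OF is_exponential_codiagonal[OF G X A B Z p \<delta> l r L] t(1)])
  moreover have "nrm T B X \<delta> (tr T A B p t) = mulT a (addT b c)"
    using mul.mackey_op_eq[OF B \<delta> add.down_in[OF finA finB p(1) t(1)]]
    by (simp only: add.push_codiagonal[OF A B p t(1)] t_eq mulT_def addT_def)
  moreover have "tr T B X \<delta> (nrm T Z B r (res T Z A L t)) = addT (mulT a b) (mulT a c)"
  proof -
    define s where "s = res T Z A L t"
    have s: "s \<in> val T Z" unfolding s_def by (rule add.up_in[OF finZ finA L(1) t(1)])
    \<comment> \<open>As r folds each copy of \<open>B\<close> separately, its base change to copy i
      is the folding map on the i-th copy of \<open>B\<close>, where s restricts to the pair
      selected by \<open>l i\<close>.\<close>
    have "res T X B (\<iota> i) (nrm T Z B r s) = mulT a ([b, c] ! i)" if i: "i < 2" for i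
    proof -
      have "res T X B (\<iota> i) (nrm T Z B r s) = nrm T B X \<delta> (res T B Z (\<zeta> i) s)"
      proof (rule mul.up_down)
        show "\<exists>w\<in>pts B. \<zeta> i w = z \<and> \<delta> w = x"
          if z: "z \<in> pts Z" and x: "x \<in> pts X" and rz: "r z = \<iota> i x" for z x
        proof -
          obtain j w where "j < 2" "w \<in> pts B" "z = \<zeta> j w" by (rule disjoint_union_cases[OF Z z])
          moreover from this have "j = i \<and> \<delta> w = x"
            using rz i x r(2) disjoint_union_eq_iff[OF B] ghom_closed[OF \<delta>(1)] by auto
          ultimately show ?thesis by auto
        qed
      qed (use X finB finZ r \<iota> \<zeta> \<delta> s i disjoint_union_eq_iff[OF Z] in auto)
      also have "res T B Z (\<zeta> i) s = res T B A (l i) t"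
        unfolding s_def using finB finZ finA \<zeta>(1)[OF i] L(1) l(1)[OF i] L(2)[OF i] t(1)
        by (rule add.up_up)
      also have "nrm T B X \<delta> (res T B A (l i) t) =
        mulT (res T X B (\<iota> 0) (res T B A (l i) t)) (res T X B (\<iota> 1) (res T B A (l i) t))"
        unfolding mulT_def
        using mul.mackey_op_eq[OF B \<delta> add.up_in[OF finB finA l(1)[OF i] t(1)]] by simp
      also have "res T X B (\<iota> 0) (res T B A (l i) t) = res T X A (\<kappa> 0) t"
        by (rule add.up_up) (use X finB finA \<iota> \<kappa> l i t in auto)
      also have "res T X B (\<iota> 1) (res T B A (l i) t) = res T X A (\<kappa> (Suc i)) t"
        by (rule add.up_up) (use X finB finA \<iota> \<kappa> l i t in auto)
      finally show ?thesis using t(2) i by simp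
    qed
    from this[of 0] this[of 1] show ?thesis
      using add.mackey_op_eq[OF B \<delta> mul.down_in[OF finZ finB r(1) s]]
      by (simp add: addT_def s_def)
  qed
  ultimately show ?thesis by simp
qed

section \<open>The values as commutative rings\<close>

lemma tambara_cring:
  assumes X: "fin_gset G X"
  shows "cring (tambara_ring G T X)"
proof (rule cringI)
  \<comment> \<open>Supplies the additive inverses, which the semi-Mackey lemmas cannot
    give.\<close>
  interpret A: comm_group "mackey_monoid G (val T) (res T) (tr T) X"
    by (rule add.comm_group[OF X])
  show "abelian_group (tambara_ring G T X)"
  proof (rule abelian_groupI)
    fix x assume "x \<in> carrier (tambara_ring G T X)"
    then show "\<exists>y\<in>carrier (tambara_ring G T X).
      y \<oplus>\<^bsub>tambara_ring G T X\<^esub> x = \<zero>\<^bsub>tambara_ring G T X\<^esub>"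
      using A.l_inv_ex[of x] by (simp add: tambara_ring_def mackey_monoid_def)
  qed (use X in \<open>auto simp: tambara_ring_def add.mackey_op_closed add.mackey_op_assoc
      add.mackey_unit intro: add.mackey_op_commute\<close>)
  show "comm_monoid (tambara_ring G T X)"
    by (rule comm_monoidI)
      (use X in \<open>auto simp: tambara_ring_def mul.mackey_op_closed mul.mackey_op_assoc
        mul.mackey_unit intro: mul.mackey_op_commute\<close>)
  fix x y z
  assume "x \<in> carrier (tambara_ring G T X)" "y \<in> carrier (tambara_ring G T X)"
    "z \<in> carrier (tambara_ring G T X)"
  then have xyz: "x \<in> val T X" "y \<in> val T X" "z \<in> val T X" by (simp_all add: tambara_ring_def)
  then show "(x \<oplus>\<^bsub>tambara_ring G T X\<^esub> y) \<otimes>\<^bsub>tambara_ring G T X\<^esub> z =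
    x \<otimes>\<^bsub>tambara_ring G T X\<^esub> z \<oplus>\<^bsub>tambara_ring G T X\<^esub> y \<otimes>\<^bsub>tambara_ring G T X\<^esub> z"
    using tambara_distrib[OF X xyz(3,1,2)] mul.mackey_op_commute[OF X, of z]
      add.mackey_op_closed[OF X] by (simp add: tambara_ring_def)
qed

end

section \<open>The kernel of a morphism\<close>

theorem proposition2p10:
  fixes G :: "('g, 'm) monoid_scheme"
    and T :: "('g, 'u::infinite, 't) tambara"
    and S :: "('g, 'u, 's) tambara"
    and \<phi> :: "('g, 'u) gset \<Rightarrow> 't \<Rightarrow> 's"
  assumes "group G" and "finite (carrier G)"
    and "tambara_functor G T" and "tambara_functor G S"
    and "tambara_hom G T S \<phi>"
  shows "tambara_ideal G T (tambara_ker G T S \<phi>)"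
  unfolding tambara_ideal_def
proof (intro conjI allI impI)
  interpret T: tambara_functor G T by fact
  interpret S: tambara_functor G S by fact
  have ring_hom: "ring_hom_ring (tambara_ring G T X) (tambara_ring G S X) (\<phi> X)" if "fin_gset G X" for X
    using that assms(5) T.tambara_cring S.tambara_cring
    by (intro ring_hom_ringI2) (auto simp: tambara_hom_def cring.axioms(1))
  show "ideal (tambara_ker G T S \<phi> X) (tambara_ring G T X)" if "fin_gset G X" for X
    unfolding tambara_ker_def by (rule ring_hom_ring.kernel_is_ideal[OF ring_hom[OF that]])
  \<comment> \<open>The zero of a value ring is the unit for \<open>tr\<close>, so closure under
    \<open>res\<close> and \<open>tr\<close> reduces to their preserving that unit in
    \<open>S\<close>.\<close>
  have ker_iff: "x \<in> tambara_ker G T S \<phi> X \<longleftrightarrow>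
    x \<in> val T X \<and> \<phi> X x = mackey_unit G (val S) (res S) (tr S) X" for x X
    by (simp add: tambara_ker_def a_kernel_def kernel_def tambara_ring_def)
  fix X Y :: "('g, 'u) gset" and f
  assume "fin_gset G X \<and> fin_gset G Y \<and> f \<in> ghom G X Y"
  then have X: "fin_gset G X" and Y: "fin_gset G Y" and f: "f \<in> ghom G X Y" by auto
  have hom: "\<And>b. b \<in> val T Y \<Longrightarrow> \<phi> X (res T X Y f b) = res S X Y f (\<phi> Y b)"
    "\<And>a. a \<in> val T X \<Longrightarrow> \<phi> Y (tr T X Y f a) = tr S X Y f (\<phi> X a)"
    "\<And>a. a \<in> val T X \<Longrightarrow> \<phi> Y (nrm T X Y f a) = nrm S X Y f (\<phi> X a)"
    using assms(5) X Y f unfolding tambara_hom_def by blast+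
  show "res T X Y f ` tambara_ker G T S \<phi> Y \<subseteq> tambara_ker G T S \<phi> X"
    using T.add.up_in[OF X Y f] S.add.up_mackey_unit[OF X Y f] by (auto simp: ker_iff hom)
  show "tr T X Y f ` tambara_ker G T S \<phi> X \<subseteq> tambara_ker G T S \<phi> Y"
    using T.add.down_in[OF X Y f] S.add.down_mackey_unit[OF X Y f] by (auto simp: ker_iff hom)
  show "nrm T X Y f ` tambara_ker G T S \<phi> X \<subseteq>
    nrm T X Y f \<zero>\<^bsub>tambara_ring G T X\<^esub> <+\<^bsub>tambara_ring G T Y\<^esub> tambara_ker G T S \<phi> Y"
  proof (rule image_subsetI)
    interpret RX: ring_hom_ring "tambara_ring G T X" "tambara_ring G S X" "\<phi> X"
      by (rule ring_hom[OF X])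
    interpret RY: ring_hom_ring "tambara_ring G T Y" "tambara_ring G S Y" "\<phi> Y"
      by (rule ring_hom[OF Y])
    have carrier: "carrier (tambara_ring G T W) = val T W" for W by (simp add: tambara_ring_def)
    let ?m = "nrm T X Y f \<zero>\<^bsub>tambara_ring G T X\<^esub>"
    fix a assume "a \<in> tambara_ker G T S \<phi> X"
    \<comment> \<open>Vanishing is restated as equality with the image of 0, an equation to which
      the norm of \<open>S\<close> can be applied without knowing its value at 0.\<close>
    then have a: "a \<in> val T X" "\<phi> X a = \<phi> X \<zero>\<^bsub>tambara_ring G T X\<^esub>"
      using RX.hom_zero by (auto simp: ker_iff) (simp add: tambara_ring_def)
    let ?n = "nrm T X Y f a"
    have zero: "\<zero>\<^bsub>tambara_ring G T X\<^esub> \<in> val T X"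
      using RX.R.zero_closed by (simp add: carrier)
    have mn: "?m \<in> carrier (tambara_ring G T Y)" "?n \<in> carrier (tambara_ring G T Y)"
      using T.mul.down_in[OF X Y f] a zero by (auto simp: carrier)
    have "\<phi> Y ?n = \<phi> Y ?m" using hom(3)[OF a(1)] hom(3)[OF zero] a(2) by argo
    then have "\<phi> Y (?n \<oplus>\<^bsub>tambara_ring G T Y\<^esub> \<ominus>\<^bsub>tambara_ring G T Y\<^esub> ?m) =
      \<zero>\<^bsub>tambara_ring G S Y\<^esub>"
      using RY.hom_add[OF mn(2) RY.R.a_inv_closed[OF mn(1)]] RY.hom_a_inv[OF mn(1)]
        RY.S.r_neg[OF RY.hom_closed[OF mn(1)]] by argo
    then have "?n \<oplus>\<^bsub>tambara_ring G T Y\<^esub> \<ominus>\<^bsub>tambara_ring G T Y\<^esub> ?m \<in>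
      a_kernel (tambara_ring G T Y) (tambara_ring G S Y) (\<phi> Y)"
      unfolding a_kernel_def' using RY.R.a_closed[OF mn(2) RY.R.a_inv_closed[OF mn(1)]] by (intro CollectI conjI)
    \<comment> \<open>The coset decomposition: the norm of a is the norm of 0 plus their difference,
      just shown to lie in the kernel.\<close>
    moreover have "?n = ?m \<oplus>\<^bsub>tambara_ring G T Y\<^esub>
      (?n \<oplus>\<^bsub>tambara_ring G T Y\<^esub> \<ominus>\<^bsub>tambara_ring G T Y\<^esub> ?m)"
      using RY.R.a_lcomm[OF mn RY.R.a_inv_closed[OF mn(1)]] RY.R.r_neg[OF mn(1)] RY.R.r_zero[OF mn(2)]
      by argo
    ultimately show "?n \<in> ?m <+\<^bsub>tambara_ring G T Y\<^esub> tambara_ker G T S \<phi> Y"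
      unfolding tambara_ker_def a_l_coset_def' by blast
  qed
qed

end
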